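(* Let $p,p'$ be integers with $1<p<p'<3p/2$ and $\gcd(p,p')=1$, and let integers $1\le r<p$ and $1\le s<p'$ be fixed by $|p'(r-s)+ps|=1$. Let $d''$, $\mathcal I''$ and $B''$ be the integer and the $d''\times d''$ matrices attached to the continued fraction expansion of $p'/(p'-p)$ as described in the context. Then for every $L\in\mathbb Z$, $$\sum_{m} q^{\frac12 mB''m}\prod_{j=1}^{d''}\genfrac{[}{]}{0pt}{}{L\delta_{j,1}+\frac12(\mathcal I''m)_j}{m_j}$$ $$=\sum_{j=-\infty}^{\infty}\Bigl\{q^{j(p'(2p'-p)j+1)}\genfrac{[}{]}{0pt}{}{L}{2p'j}_2-q^{(p'j+s)((2p'-p)j+r+s)}\genfrac{[}{]}{0pt}{}{L}{2p'j+2s}_2\Bigr\},$$ where the left-hand sum is over all $m\in\mathbb Z^{d''}$ such that $m_1+m_2$ and $m_3,\dots,m_{d''}$ are all even.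
   Context: $q$ is an indeterminate. $(q)_0=1$, $(q)_n=\prod_{j=1}^n(1-q^j)$ for $n\ge1$. $\genfrac{[}{]}{0pt}{}{n}{a}=\frac{(q)_n}{(q)_a(q)_{n-a}}$ if $0\le a\le n$, and $0$ otherwise (in particular $0$ if $n<0$). The $q$-trinomial coefficients are $$\genfrac{[}{]}{0pt}{}{L,b}{a}_2=\sum_{k\ge0}q^{k(k+b)}\genfrac{[}{]}{0pt}{}{L}{k}\genfrac{[}{]}{0pt}{}{L-k}{k+a},\qquad \genfrac{[}{]}{0pt}{}{L}{a}_2=\genfrac{[}{]}{0pt}{}{L,a}{a}_2 .$$ Matrices. Write the continued fraction expansion $\frac{p'}{p'-p}=[\nu_0,\dots,\nu_{n-1},\nu_n+2]=\nu_0+1/(\nu_1+1/(\cdots+1/(\nu_n+2)))$ with integers $n\ge0$, $\nu_0,\dots,\nu_{n-1}\ge1$, $\nu_n\ge0$. Put $t_m=\sum_{j=0}^{m-1}\nu_j$ for $1\le m\le n$ and $d'=\sum_{j=0}^n\nu_j$. The $d'\times d'$ matrix $\mathcal I'$ has entries $$\mathcal I'_{i,j}=\begin{cases}\delta_{i,j+1}+\delta_{i,j-1} & \text{for } 1\le i<d',\ i\ne t_m,\\ \delta_{i,j+1}+\delta_{i,j}-\delta_{i,j-1} & \text{for } i=t_m,\ 1\le m\le n-\delta_{\nu_n,0},\\ \delta_{i,j+1}+\delta_{\nu_n,0}\,\delta_{i,j} & \text{for } i=d'.\end{cases}$$ Put $d''=d'+1$. The $d''\times d''$ matrix $\mathcal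 I''$ has entries $$\mathcal I''_{i,j}=\begin{cases}\delta_{i,3}-\delta_{j,3} & \text{for } i=1\text{ or }j=1,\\ \mathcal I'_{i-1,j-1} & \text{for } i,j=2,\dots,d'',\end{cases}$$ and $B''$ is defined by $2B''=2I-\mathcal I''$ with $I$ the identity matrix. Notation: $mB''m=\sum_{j,k}m_jB''_{j,k}m_k$ and $(\mathcal I''m)_j=\sum_k\mathcal I''_{j,k}m_k$. *)

theory Defs
  imports "HOL-Computational_Algebra.Formal_Laurent_Series"
begin

text \<open>
  The indeterminate \<open>q\<close> is the generator of the field of formal Laurent series over the rationals,
  so that negative powers and quotients make sense. Infinite sums with only finitely many nonzero
  terms are written with \<^const>\<open>sum'\<close>, which returns 0 if there are infinitely many nonzero terms.
\<close>

abbreviation q :: "rat fls" where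
  "q \<equiv> fls_X"

definition qpoch :: "nat \<Rightarrow> rat fls" where
  "qpoch n = (\<Prod>j=1..n. 1 - q ^ j)"

definition qbinom :: "int \<Rightarrow> int \<Rightarrow> rat fls" where
  "qbinom n a = (if 0 \<le> a \<and> a \<le> n
     then qpoch (nat n) / (qpoch (nat a) * qpoch (nat (n - a))) else 0)"

definition qtrinom_gen :: "int \<Rightarrow> int \<Rightarrow> int \<Rightarrow> rat fls" where
  "qtrinom_gen L b a =
     sum' (\<lambda>k. q powi (k * (k + b)) * qbinom L k * qbinom (L - k) (k + a)) {0..}"

definition qtrinom :: "int \<Rightarrow> int \<Rightarrow> rat fls" where
  "qtrinom L a = qtrinom_gen L a a"

fun cf_value :: "nat list \<Rightarrow> rat" where
  "cf_value [] = 0"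
| "cf_value [x] = of_nat x"
| "cf_value (x # y # xs) = of_nat x + 1 / cf_value (y # xs)"

text \<open>The partial quotients are \<open>\<nu> 0, \<dots>, \<nu> (n - 1), \<nu> n + 2\<close>; values of \<open>\<nu>\<close> beyond \<open>n\<close> are irrelevant.\<close>

definition cf_expansion :: "rat \<Rightarrow> nat \<Rightarrow> (nat \<Rightarrow> nat) \<Rightarrow> bool" where
  "cf_expansion x n \<nu> \<longleftrightarrow> (\<forall>i<n. 1 \<le> \<nu> i) \<and> x = cf_value (map \<nu> [0..<n] @ [\<nu> n + 2])"

definition tpos :: "(nat \<Rightarrow> nat) \<Rightarrow> nat \<Rightarrow> nat" where
  "tpos \<nu> m = (\<Sum>j<m. \<nu> j)"

definition dim' :: "nat \<Rightarrow> (nat \<Rightarrow> nat) \<Rightarrow> nat" where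
  "dim' n \<nu> = (\<Sum>j\<le>n. \<nu> j)"

text \<open>
  Matrices and vectors are functions with indices starting at 1; only the entries with indices up
  to the dimension matter. The Kronecker delta is \<^const>\<open>of_bool\<close> of an equation.
\<close>

definition I' :: "nat \<Rightarrow> (nat \<Rightarrow> nat) \<Rightarrow> nat \<Rightarrow> nat \<Rightarrow> int" where
  "I' n \<nu> i j =
    (if i = dim' n \<nu> then of_bool (i = j + 1) + of_bool (\<nu> n = 0) * of_bool (i = j)
     else if \<exists>m\<in>{1..n - of_bool (\<nu> n = 0)}. i = tpos \<nu> m
       then of_bool (i = j + 1) + of_bool (i = j) - of_bool (i + 1 = j)
     else of_bool (i = j + 1) + of_bool (i + 1 = j))"

definition dim'' :: "nat \<Rightarrow> (nat \<Rightarrow> nat) \<Rightarrow> nat" where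
  "dim'' n \<nu> = dim' n \<nu> + 1"

definition I'' :: "nat \<Rightarrow> (nat \<Rightarrow> nat) \<Rightarrow> nat \<Rightarrow> nat \<Rightarrow> int" where
  "I'' n \<nu> i j =
    (if i = 1 \<or> j = 1 then of_bool (i = 3) - of_bool (j = 3) else I' n \<nu> (i - 1) (j - 1))"

definition B'' :: "nat \<Rightarrow> (nat \<Rightarrow> nat) \<Rightarrow> nat \<Rightarrow> nat \<Rightarrow> rat" where
  "B'' n \<nu> i j = (2 * of_bool (i = j) - of_int (I'' n \<nu> i j)) / 2"

definition B''_form :: "nat \<Rightarrow> (nat \<Rightarrow> nat) \<Rightarrow> (nat \<Rightarrow> int) \<Rightarrow> rat" where
  "B''_form n \<nu> m =
    (\<Sum>j=1..dim'' n \<nu>. \<Sum>k=1..dim'' n \<nu>. of_int (m j) * B'' n \<nu> j k * of_int (m k))"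

definition I''_app :: "nat \<Rightarrow> (nat \<Rightarrow> nat) \<Rightarrow> (nat \<Rightarrow> int) \<Rightarrow> nat \<Rightarrow> int" where
  "I''_app n \<nu> m j = (\<Sum>k=1..dim'' n \<nu>. I'' n \<nu> j k * m k)"

text \<open>Vectors in \<open>\<int>\<^sup>d\<close>, \<open>d = dim'' n \<nu>\<close>, are represented by functions that vanish off \<open>{1..d}\<close>.\<close>

definition summation_vectors :: "nat \<Rightarrow> (nat \<Rightarrow> nat) \<Rightarrow> (nat \<Rightarrow> int) set" where
  "summation_vectors n \<nu> =
    {m. (\<forall>j. j \<notin> {1..dim'' n \<nu>} \<longrightarrow> m j = 0) \<and>
        even (m 1 + m 2) \<and> (\<forall>j\<in>{3..dim'' n \<nu>}. even (m j))}"


text \<open>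
  In the statement, the exponent \<open>m B'' m / 2\<close> and the upper entries of the \<open>q\<close>-binomials are rounded
  down to integers, and possibly infinite index sets occur in \<^const>\<open>sum'\<close>. The remaining lemmas
  show that the rounding has no effect, that all these sums have finitely many nonzero terms, and
  that the continued fraction expansion exists.
\<close>

lemma qbinom_nonzeroD: "qbinom n a \<noteq> 0 \<Longrightarrow> 0 \<le> a \<and> a \<le> n"
  by (auto simp: qbinom_def split: if_splits)

lemma qtrinom_finite_support:
  "finite {k \<in> {0..}. q powi (k * (k + b)) * qbinom L k * qbinom (L - k) (k + a) \<noteq> 0}"
  by (rule finite_subset[of _ "{0..L}"]) (auto dest: qbinom_nonzeroD)

lemma qtrinom_nonzeroD: "qtrinom L a \<noteq> 0 \<Longrightarrow> \<bar>a\<bar> \<le> L"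
proof (rule ccontr)
  assume nz: "qtrinom L a \<noteq> 0" and a: "\<not> \<bar>a\<bar> \<le> L"
  have "{k \<in> {0..}. q powi (k * (k + a)) * qbinom L k * qbinom (L - k) (k + a) \<noteq> 0} = {}"
    using a by (auto dest!: qbinom_nonzeroD)
  then have "qtrinom L a = 0"
    unfolding qtrinom_def qtrinom_gen_def sum.G_def by (simp only: sum.empty if_cancel)
  with nz show False ..
qed

lemma bosonic_finite_support:
  fixes p p' r s L :: int
  assumes "0 < p'"
  shows "finite {j \<in> UNIV. q powi (j * (p' * (2 * p' - p) * j + 1)) * qtrinom L (2 * p' * j)
        - q powi ((p' * j + s) * ((2 * p' - p) * j + r + s)) * qtrinom L (2 * p' * j + 2 * s) \<noteq> 0}"
proof (rule finite_subset[of _ "{-(L + 2 * \<bar>s\<bar>)..L + 2 * \<bar>s\<bar>}"]; safe?)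
  fix j :: int
  assume "q powi (j * (p' * (2 * p' - p) * j + 1)) * qtrinom L (2 * p' * j)
        - q powi ((p' * j + s) * ((2 * p' - p) * j + r + s)) * qtrinom L (2 * p' * j + 2 * s) \<noteq> 0"
  then have "qtrinom L (2 * p' * j) \<noteq> 0 \<or> qtrinom L (2 * p' * j + 2 * s) \<noteq> 0"
    by auto
  then have "\<bar>2 * p' * j\<bar> \<le> L \<or> \<bar>2 * p' * j + 2 * s\<bar> \<le> L"
    by (auto dest: qtrinom_nonzeroD)
  then have 1: "\<bar>2 * p' * j\<bar> \<le> L + 2 * \<bar>s\<bar>"
    by linarith
  have "1 * \<bar>j\<bar> \<le> (2 * p') * \<bar>j\<bar>"
    using assms by (intro mult_right_mono) auto
  with 1 have "\<bar>j\<bar> \<le> L + 2 * \<bar>s\<bar>"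
    using assms by (simp add: abs_mult)
  then show "j \<in> {-(L + 2 * \<bar>s\<bar>)..L + 2 * \<bar>s\<bar>}"
    by auto
qed

lemma cf_value_gt_1:
  "\<forall>x\<in>set xs. 1 \<le> x \<Longrightarrow> 2 \<le> y \<Longrightarrow> 1 < cf_value (xs @ [y])"
proof (induction xs)
  case Nil
  then show ?case by simp
next
  case (Cons x xs)
  then have "0 < 1 / cf_value (xs @ [y])" by simp
  moreover have "(1 :: rat) \<le> of_nat x"
    using Cons.prems by simp
  moreover obtain z zs where "xs @ [y] = z # zs"
    by (cases xs) auto
  ultimately show ?case
    by (simp only: append_Cons cf_value.simps)
qed

lemma cf_expansion_head:
  assumes "cf_expansion x n \<nu>" and "3 < x"
  shows "2 \<le> \<nu> 0 \<and> (0 < n \<longrightarrow> 3 \<le> \<nu> 0)"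
proof (cases n)
  case 0
  then have "x = of_nat (\<nu> 0 + 2)"
    using assms by (simp add: cf_expansion_def)
  with assms have "of_nat 3 < (of_nat (\<nu> 0 + 2) :: rat)" by simp
  then have "3 < \<nu> 0 + 2" by (simp only: of_nat_less_iff)
  with 0 show ?thesis by simp
next
  case (Suc k)
  define c where "c = cf_value (map \<nu> [1..<n] @ [\<nu> n + 2])"
  have "1 < c"
    unfolding c_def using assms by (intro cf_value_gt_1) (auto simp: cf_expansion_def)
  moreover have "x = of_nat (\<nu> 0) + 1 / c"
  proof -
    obtain z zs where z: "map \<nu> [1..<n] @ [\<nu> n + 2] = z # zs"
      by (cases "map \<nu> [1..<n]") auto
    have "[0..<n] = 0 # [1..<n]"
      using Suc by (simp add: upt_conv_Cons)
    then have "map \<nu> [0..<n] @ [\<nu> n + 2] = \<nu> 0 # z # zs"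
      using z by simp
    then show ?thesis
      using assms z by (simp add: cf_expansion_def c_def)
  qed
  ultimately have "x < of_nat (\<nu> 0) + 1"
    by simp
  with assms(2) have "of_nat 2 < (of_nat (\<nu> 0) :: rat)"
    by simp
  then have "2 < \<nu> 0" by (simp only: of_nat_less_iff)
  then show ?thesis by simp
qed

lemma cf_value_exists:
  fixes a b :: nat
  assumes "0 < b" and "b < a"
  shows "\<exists>xs y. (\<forall>x\<in>set xs. 1 \<le> x) \<and> 2 \<le> y \<and> of_nat a / of_nat b = cf_value (xs @ [y])"
  using assms
proof (induction b arbitrary: a rule: less_induct)
  case (less b)
  have a: "a = a div b * b + a mod b" by simp
  then have a': "(of_nat a :: rat) = of_nat (a div b) * of_nat b + of_nat (a mod b)"
    by (metis of_nat_add of_nat_mult)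
  show ?case
  proof (cases "a mod b = 0")
    case True
    have "2 \<le> a div b"
    proof (rule ccontr)
      assume "\<not> 2 \<le> a div b"
      then have "a div b * b \<le> 1 * b" by (intro mult_right_mono) auto
      with a True less.prems show False by linarith
    qed
    then show ?thesis
      using True a' less.prems by (intro exI[of _ "[]"] exI[of _ "a div b"]) (simp add: field_simps)
  next
    case False
    then obtain xs y where xs: "\<forall>x\<in>set xs. 1 \<le> x" "2 \<le> y"
      "of_nat b / of_nat (a mod b) = cf_value (xs @ [y])"
      using less.IH[of "a mod b" b] less.prems by auto
    obtain z zs where z: "xs @ [y] = z # zs" by (cases xs) auto
    have "of_nat a / of_nat b = of_nat (a div b) + 1 / (of_nat b / of_nat (a mod b) :: rat)"
      using a' less.prems False by (simp add: field_simps)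
    also have "\<dots> = cf_value ((a div b # xs) @ [y])"
      using xs(3) z by simp
    finally have "of_nat a / of_nat b = cf_value ((a div b # xs) @ [y])" .
    moreover have "1 \<le> a div b"
      using less.prems by (simp add: div_greater_zero_iff Suc_le_eq)
    ultimately show ?thesis
      using xs by (intro exI[of _ "a div b # xs"] exI[of _ y]) auto
  qed
qed

lemma cf_expansion_exists:
  fixes p p' :: int
  assumes "0 < p" and "p < p'"
  shows "\<exists>n \<nu>. cf_expansion (of_int p' / of_int (p' - p)) n \<nu>"
proof -
  obtain xs y where xs: "\<forall>x\<in>set xs. 1 \<le> x" "2 \<le> y"
      "of_nat (nat p') / of_nat (nat (p' - p)) = cf_value (xs @ [y])"
    using cf_value_exists[of "nat (p' - p)" "nat p'"] assms by auto
  define \<nu> where "\<nu> = (\<lambda>i. if i < length xs then xs ! i else y - 2)"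
  have "map \<nu> [0..<length xs] = xs"
    by (rule nth_equalityI) (simp_all add: \<nu>_def)
  moreover have "\<nu> (length xs) + 2 = y"
    using xs by (simp add: \<nu>_def)
  ultimately have "cf_expansion (of_int p' / of_int (p' - p)) (length xs) \<nu>"
    using xs assms by (auto simp: cf_expansion_def \<nu>_def)
  then show ?thesis by blast
qed

lemma cf_expansion_shape:
  fixes p p' :: int
  assumes "0 < p" and "p < p'" and "2 * p' < 3 * p"
    and "cf_expansion (of_int p' / of_int (p' - p)) n \<nu>"
  shows "2 \<le> dim' n \<nu>" and "1 \<le> m \<Longrightarrow> m \<le> n \<Longrightarrow> 3 \<le> tpos \<nu> m"
proof -
  have "of_int (3 * (p' - p)) < (of_int p' :: rat)"
    using assms by (subst of_int_less_iff) simp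
  then have "3 < of_int p' / (of_int (p' - p) :: rat)"
    using assms by (simp add: field_simps)
  from cf_expansion_head[OF assms(4) this]
  have *: "2 \<le> \<nu> 0" "0 < n \<Longrightarrow> 3 \<le> \<nu> 0" by auto
  have "\<nu> 0 \<le> dim' n \<nu>"
    unfolding dim'_def by (rule member_le_sum) auto
  with * show "2 \<le> dim' n \<nu>" by simp
  show "3 \<le> tpos \<nu> m" if "1 \<le> m" "m \<le> n"
  proof -
    have "\<nu> 0 \<le> tpos \<nu> m"
      unfolding tpos_def using that by (intro member_le_sum) auto
    with * that show ?thesis by simp
  qed
qed

locale fermionic_shape =
  fixes n :: nat and \<nu> :: "nat \<Rightarrow> nat"
  assumes dim'_ge: "2 \<le> dim' n \<nu>"
    and tpos_ge: "1 \<le> m \<Longrightarrow> m \<le> n \<Longrightarrow> 3 \<le> tpos \<nu> m"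
begin

lemma I'_rows:
  "1 \<le> j \<Longrightarrow> I' n \<nu> (Suc 0) j = of_bool (j = 2)"
  "I' n \<nu> 2 (Suc 0) = 1"
  "3 \<le> i \<Longrightarrow> I' n \<nu> i (Suc 0) = 0"
proof -
  have "3 \<le> tpos \<nu> m" if "m \<in> {1..n - c}" for m c
    using that by (intro tpos_ge) auto
  then have no: "(\<exists>m\<in>{1..n - c}. i = tpos \<nu> m) \<longleftrightarrow> False" if "i < 3" for i c
    using that by fastforce
  show "1 \<le> j \<Longrightarrow> I' n \<nu> (Suc 0) j = of_bool (j = 2)"
    using dim'_ge no[of "Suc 0"] unfolding I'_def by (simp only: no) auto
  show "I' n \<nu> 2 (Suc 0) = 1"
    using dim'_ge no[of 2] unfolding I'_def by auto
  show "3 \<le> i \<Longrightarrow> I' n \<nu> i (Suc 0) = 0"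
    by (auto simp: I'_def)
qed

lemma summation_vectors_even:
  assumes "m \<in> summation_vectors n \<nu>"
  shows "even (m 1 + m 2)" and "3 \<le> k \<Longrightarrow> even (m k)"
proof -
  show "even (m 1 + m 2)"
    using assms by (simp add: summation_vectors_def)
  show "even (m k)" if "3 \<le> k"
    using assms that by (cases "k \<le> dim'' n \<nu>") (simp_all add: summation_vectors_def)
qed

lemma I''_app_1: "I''_app n \<nu> m (Suc 0) = - m 3"
  and I''_app_2: "I''_app n \<nu> m 2 = m 3"
proof -
  have "I''_app n \<nu> m (Suc 0) = (\<Sum>k=1..dim'' n \<nu>. if k = 3 then - m k else 0)"
    unfolding I''_app_def by (intro sum.cong) (auto simp: I''_def)
  then show "I''_app n \<nu> m (Suc 0) = - m 3"
    using dim'_ge by (simp add: dim''_def)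
  have "I''_app n \<nu> m 2 = (\<Sum>k=1..dim'' n \<nu>. if k = 3 then m k else 0)"
    unfolding I''_app_def by (intro sum.cong) (auto simp: I''_def I'_rows)
  then show "I''_app n \<nu> m 2 = m 3"
    using dim'_ge by (simp add: dim''_def)
qed

lemma even_I''_app:
  assumes m: "m \<in> summation_vectors n \<nu>" and j: "j \<in> {1..dim'' n \<nu>}"
  shows "even (I''_app n \<nu> m j)"
proof -
  have ev: "even (m 1 + m 2)" "\<And>k. 3 \<le> k \<Longrightarrow> even (m k)"
    using summation_vectors_even[OF m] by blast+
  consider "j = Suc 0" | "j = 2" | "3 \<le> j" using j by force
  then show ?thesis
  proof cases
    case 3
    have "{1..dim'' n \<nu>} = {1, 2} \<union> {3..dim'' n \<nu>}"
      using dim'_ge by (auto simp: dim''_def)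
    then have "I''_app n \<nu> m j = (\<Sum>k\<in>{1, 2}. I'' n \<nu> j k * m k) + (\<Sum>k=3..dim'' n \<nu>. I'' n \<nu> j k * m k)"
      unfolding I''_app_def by (simp only:) (rule sum.union_disjoint, auto)
    moreover have "even (\<Sum>k=3..dim'' n \<nu>. I'' n \<nu> j k * m k)"
      using ev(2) by (intro dvd_sum) auto
    moreover have "(\<Sum>k\<in>{1, 2}. I'' n \<nu> j k * m k) = of_bool (j = 3) * (m 1 + m 2)"
      using 3 by (cases "j = 3") (auto simp: I''_def I'_rows)
    ultimately show ?thesis using ev(1) by simp
  qed (auto simp: I''_app_1 I''_app_2 ev)
qed

lemma upper_entry_int:
  assumes "m \<in> summation_vectors n \<nu>" and "j \<in> {1..dim'' n \<nu>}"
  shows "of_int (L * of_bool (j = 1)) + of_int (I''_app n \<nu> m j) / (2 :: rat) \<in> \<int>"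
proof -
  obtain k where "I''_app n \<nu> m j = 2 * k"
    using even_I''_app[OF assms] by blast
  then show ?thesis by simp
qed

lemma B''_form_half_int:
  assumes m: "m \<in> summation_vectors n \<nu>"
  shows "B''_form n \<nu> m / 2 \<in> \<int>"
proof -
  let ?d = "dim'' n \<nu>"
  let ?f = "\<lambda>j. m j * (2 * m j - I''_app n \<nu> m j)"
  have row: "(\<Sum>k=1..?d. of_int (m j) * B'' n \<nu> j k * of_int (m k)) = of_int (?f j) / 2"
    if "j \<in> {1..?d}" for j
  proof -
    have "(\<Sum>k=1..?d. of_int (m j) * B'' n \<nu> j k * of_int (m k))
        = (\<Sum>k=1..?d. of_int (m j) * (if k = j then of_int (m k) else 0))
          - (\<Sum>k=1..?d. of_int (m j) / 2 * of_int (I'' n \<nu> j k * m k))"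
      unfolding sum_subtractf[symmetric]
      by (intro sum.cong) (auto simp: B''_def field_simps)
    also have "\<dots> = of_int (?f j) / 2"
      unfolding sum_distrib_left[symmetric] I''_app_def using that
      by (simp add: field_simps)
    finally show ?thesis .
  qed
  have "B''_form n \<nu> m = (\<Sum>j=1..?d. of_int (?f j) / 2)"
    unfolding B''_form_def by (intro sum.cong row) auto
  also have "\<dots> = of_int (\<Sum>j=1..?d. ?f j) / 2"
    unfolding of_int_sum sum_divide_distrib ..
  finally have form: "B''_form n \<nu> m / 2 = of_int (\<Sum>j=1..?d. ?f j) / 4"
    by simp
  have ev: "even (m 1 + m 2)" "\<And>k. 3 \<le> k \<Longrightarrow> even (m k)"
    using summation_vectors_even[OF m] by blast+
  have "{1..?d} = {1, 2} \<union> {3..?d}"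
    using dim'_ge by (auto simp: dim''_def)
  then have "(\<Sum>j=1..?d. ?f j) = (\<Sum>j\<in>{1, 2}. ?f j) + (\<Sum>j=3..?d. ?f j)"
    by (simp only:) (rule sum.union_disjoint, auto)
  moreover have "4 dvd (\<Sum>j=3..?d. ?f j)"
  proof (intro dvd_sum)
    fix j assume "j \<in> {3..?d}"
    then have "even (m j)" "even (2 * m j - I''_app n \<nu> m j)"
      using ev(2) even_I''_app[OF m] by auto
    then have "2 * 2 dvd ?f j" by (rule mult_dvd_mono)
    then show "4 dvd ?f j" by simp
  qed
  moreover have "4 dvd (\<Sum>j\<in>{1, 2}. ?f j)"
  proof -
    obtain a where a: "m 3 = 2 * a" using ev(2)[of 3] by auto
    obtain b where b: "m 2 = 2 * b - m 1"
      using ev(1) by (metis add_diff_cancel_left' evenE)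
    have "I''_app n \<nu> m 1 = - m 3" using I''_app_1[of m] by simp
    then have "(\<Sum>j\<in>{1, 2}. ?f j) = 4 * (m 1 * m 1 - 2 * b * m 1 + 2 * b * b + a * m 1 - a * b)"
      by (simp add: I''_app_2 a b algebra_simps del: One_nat_def)
    then show ?thesis by simp
  qed
  ultimately have "4 dvd (\<Sum>j=1..?d. ?f j)" by simp
  then obtain c where "(\<Sum>j=1..?d. ?f j) = 4 * c" by blast
  then show ?thesis unfolding form by simp
qed

lemma I''_app_tail:
  assumes j: "4 \<le> j" "j \<le> dim'' n \<nu>"
  shows "j = dim'' n \<nu> \<Longrightarrow> I''_app n \<nu> m j = m (j - 1) + of_bool (\<nu> n = 0) * m j"
    and "j < dim'' n \<nu> \<Longrightarrow>
      I''_app n \<nu> m j = m (j - 1) + m (j + 1) \<or> I''_app n \<nu> m j = m (j - 1) + m j - m (j + 1)"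
proof -
  have red: "I''_app n \<nu> m j = a * m (j - 1) + b * m j + c * (if j < dim'' n \<nu> then m (j + 1) else 0)"
    if I: "\<And>k. 2 \<le> k \<Longrightarrow> I' n \<nu> (j - 1) (k - 1) =
        a * of_bool (k = j - 1) + b * of_bool (k = j) + c * of_bool (k = j + 1)"
    for a b c
  proof -
    have "I''_app n \<nu> m j = (\<Sum>k=1..dim'' n \<nu>. a * (if k = j - 1 then m k else 0)
        + b * (if k = j then m k else 0) + c * (if k = j + 1 then m k else 0))"
      unfolding I''_app_def
    proof (intro sum.cong refl)
      fix k assume k: "k \<in> {1..dim'' n \<nu>}"
      show "I'' n \<nu> j k * m k = a * (if k = j - 1 then m k else 0)
        + b * (if k = j then m k else 0) + c * (if k = j + 1 then m k else 0)"
      proof (cases "k = 1")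
        case True
        with j show ?thesis by (auto simp: I''_def)
      next
        case False
        with k j have "I'' n \<nu> j k =
            a * of_bool (k = j - 1) + b * of_bool (k = j) + c * of_bool (k = j + 1)"
          using I[of k] by (simp add: I''_def)
        then show ?thesis by (simp add: algebra_simps)
      qed
    qed
    also have "\<dots> = a * m (j - 1) + b * m j + c * (if j < dim'' n \<nu> then m (j + 1) else 0)"
      unfolding sum.distrib sum_distrib_left[symmetric] using j by (simp, linarith?)
    finally show ?thesis .
  qed
  show "I''_app n \<nu> m j = m (j - 1) + of_bool (\<nu> n = 0) * m j" if "j = dim'' n \<nu>"
  proof -
    have "I' n \<nu> (j - 1) (k - 1) =
        1 * of_bool (k = j - 1) + of_bool (\<nu> n = 0) * of_bool (k = j) + 0 * of_bool (k = j + 1)"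
      if "2 \<le> k" for k
      using that j \<open>j = dim'' n \<nu>\<close> by (auto simp: I'_def dim''_def)
    from red[OF this] show ?thesis by simp
  qed
  show "I''_app n \<nu> m j = m (j - 1) + m (j + 1) \<or> I''_app n \<nu> m j = m (j - 1) + m j - m (j + 1)"
    if "j < dim'' n \<nu>"
  proof -
    have ne: "(j - 1 = dim' n \<nu>) = False"
      using that j by (simp add: dim''_def)
    have idx: "(j - 1 = k - 1 + 1) = (k = j - 1)" "(j - 1 = k - 1) = (k = j)"
      "(j - 1 + 1 = k - 1) = (k = j + 1)" if "2 \<le> k" for k
      using that j(1) by arith+
    show ?thesis
    proof (cases "\<exists>i\<in>{1..n - of_bool (\<nu> n = 0)}. j - 1 = tpos \<nu> i")
      case True
      have "I' n \<nu> (j - 1) (k - 1) =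
          1 * of_bool (k = j - 1) + 1 * of_bool (k = j) + (- 1) * of_bool (k = j + 1)"
        if "2 \<le> k" for k
      proof -
        have "I' n \<nu> (j - 1) (k - 1) =
            of_bool (j - 1 = k - 1 + 1) + of_bool (j - 1 = k - 1) - of_bool (j - 1 + 1 = k - 1)"
          unfolding I'_def ne if_False if_P[OF True] ..
        then show ?thesis
          unfolding idx[OF that] by (simp only: mult_1 mult_zero_left mult_minus1 add_0_right diff_conv_add_uminus)
      qed
      note row = this
      have "I''_app n \<nu> m j = 1 * m (j - 1) + 1 * m j + (- 1) * (if j < dim'' n \<nu> then m (j + 1) else 0)"
        by (rule red) (rule row)
      then show ?thesis using that by simp
    next
      case False
      have "I' n \<nu> (j - 1) (k - 1) =
          1 * of_bool (k = j - 1) + 0 * of_bool (k = j) + 1 * of_bool (k = j + 1)"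
        if "2 \<le> k" for k
      proof -
        have "I' n \<nu> (j - 1) (k - 1) =
            of_bool (j - 1 = k - 1 + 1) + of_bool (j - 1 + 1 = k - 1)"
          unfolding I'_def ne if_False if_not_P[OF False] ..
        then show ?thesis
          unfolding idx[OF that] by (simp only: mult_1 mult_zero_left mult_minus1 add_0_right diff_conv_add_uminus)
      qed
      note row = this
      have "I''_app n \<nu> m j = 1 * m (j - 1) + 0 * m j + 1 * (if j < dim'' n \<nu> then m (j + 1) else 0)"
        by (rule red) (rule row)
      then show ?thesis using that by simp
    qed
  qed
qed

lemma fermionic_finite_support:
  "finite {m \<in> summation_vectors n \<nu>.
     q powi \<lfloor>B''_form n \<nu> m / 2\<rfloor> *
        (\<Prod>j=1..dim'' n \<nu>.
          qbinom \<lfloor>of_int (L * of_bool (j = 1)) + of_int (I''_app n \<nu> m j) / (2 :: rat)\<rfloor> (m j)) \<noteq> 0}"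
    (is "finite ?S")
proof (rule finite_subset)
  let ?d = "dim'' n \<nu>"
  show "finite {m. \<forall>j. (j \<in> {1..?d} \<longrightarrow> m j \<in> {0..2 * L}) \<and> (j \<notin> {1..?d} \<longrightarrow> m j = 0)}"
    by (rule finite_set_of_finite_funs) auto
  show "?S \<subseteq> {m. \<forall>j. (j \<in> {1..?d} \<longrightarrow> m j \<in> {0..2 * L}) \<and> (j \<notin> {1..?d} \<longrightarrow> m j = 0)}"
  proof
    fix m assume m: "m \<in> ?S"
    have b: "0 \<le> m j \<and> 2 * m j \<le> 2 * L * of_bool (j = 1) + I''_app n \<nu> m j" if "j \<in> {1..?d}" for j
    proof -
      have "qbinom \<lfloor>of_int (L * of_bool (j = 1)) + of_int (I''_app n \<nu> m j) / (2 :: rat)\<rfloor> (m j) \<noteq> 0"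
        using m that by auto
      then have *: "0 \<le> m j" "of_int (m j) \<le> of_int (L * of_bool (j = 1)) + of_int (I''_app n \<nu> m j) / (2 :: rat)"
        by (blast dest: qbinom_nonzeroD le_floor_iff[THEN iffD1])+
      have "of_int (2 * m j) \<le> (of_int (2 * L * of_bool (j = 1) + I''_app n \<nu> m j) :: rat)"
        using *(2) by (simp add: field_simps del: of_bool_eq_iff)
      with *(1) show ?thesis by (simp only: of_int_le_iff)
    qed
    have d: "3 \<le> ?d" using dim'_ge by (simp add: dim''_def)
    have m1: "m 1 \<le> L" and m2: "m 2 \<le> L" and m3: "m 3 \<le> 2 * L"
      using b[of "Suc 0"] b[of 2] b[of 3] d by (auto simp: I''_app_1 I''_app_2)
    have step: "m j \<le> m (j - 1)" if "4 \<le> j" "j \<le> ?d" for j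
      using that(2,1)
    proof (induction j rule: inc_induct)
      case base
      then show ?case
        using b[of ?d] I''_app_tail(1)[of ?d m] by (cases "\<nu> n = 0") auto
    next
      case (step j)
      then have "m (Suc j) \<le> m j" "0 \<le> m (Suc j)" using b[of "Suc j"] by auto
      then show ?case
        using b[of j] I''_app_tail(2)[of j m] step by auto
    qed
    have tail: "m j \<le> 2 * L" if "3 \<le> j" "j \<le> ?d" for j
      using that
    proof (induction j rule: dec_induct)
      case base
      show ?case by (rule m3)
    next
      case (step j)
      then show ?case using \<open>\<And>j. 4 \<le> j \<Longrightarrow> j \<le> ?d \<Longrightarrow> m j \<le> m (j - 1)\<close>[of "Suc j"] by auto
    qed
    have "0 \<le> m 1" using b[of 1] d by simp
    with m1 have "0 \<le> L" by simp
    have "m j \<in> {0..2 * L}" if "j \<in> {1..?d}" for j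
    proof -
      have "j = 1 \<or> j = 2 \<or> 3 \<le> j" using that by auto
      then have "m j \<le> 2 * L"
        using m1 m2 tail[of j] that \<open>0 \<le> L\<close> by (elim disjE) simp_all
      with b[OF that] show ?thesis by auto
    qed
    moreover have "m j = 0" if "j \<notin> {1..?d}" for j
      using m that by (auto simp: summation_vectors_def)
    ultimately show "m \<in> {m. \<forall>j. (j \<in> {1..?d} \<longrightarrow> m j \<in> {0..2 * L}) \<and> (j \<notin> {1..?d} \<longrightarrow> m j = 0)}"
      by blast
  qed
qed

end

lemma fermionic_shapeI:
  fixes p p' :: int
  assumes "0 < p" and "p < p'" and "2 * p' < 3 * p"
    and "cf_expansion (of_int p' / of_int (p' - p)) n \<nu>"
  shows "fermionic_shape n \<nu>"
  by (rule fermionic_shape.intro) (fact cf_expansion_shape[OF assms])+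

end

(*
  The proof runs a Burge tree along the continued fraction. Put
    B(L, M, a, b) = [L+M+a-b; L+a] [L+M-a+b; L-a],
    F_{P,Q}(L, M) = sum_j q^(j(QPj+1)) B(L, M, Qj, Pj) - q^((Qj+s)(Pj+r)) B(L, M, Qj+s, Pj+r),
  where |Qr - Ps| = 1. The q-Pfaff-Saalschuetz sum gives the Burge transform
    F_{P,Q+P}(L, M) = sum_i q^(i^2) [2L+M-i; 2L] F_{P,Q}(L-i, i),
  the symmetry of B gives F_{P,Q}(L, M) = F_{Q,P}(M, L), and F_{1,1}(L, M) telescopes to 1 if
  L = M = 0 and to 0 otherwise. Unwinding these rules turns F_{P,Q} into a nested sum whose shape
  is read off the continued fraction of Q/P; the symmetry is used exactly at the rows t_m.

  With Q = p', P = p' - p and i = (m_1 + m_2)/2, the q-Vandermonde sum removes one of m_1, m_2 from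
  the left-hand side and leaves the factor q^(i^2) [L; 2i]. Since
    q^(a^2) [L; 2a]_2 = sum_i q^(i^2) [L; 2i] [2i; i-a],
  summation over i then produces the q-trinomials.
*)
theory Submission
  imports Defs
begin

subsection \<open>Summation formulas for \<open>q\<close>-binomials\<close>

lemma sum'_eq_sum:
  assumes "finite J" and "J \<subseteq> A" and "\<And>x. x \<in> A \<Longrightarrow> f x \<noteq> 0 \<Longrightarrow> x \<in> J"
  shows "sum' f A = sum f J"
  using assms sum.mono_neutral_right'[of J A f] by auto

lemma qpow_mult: "q powi a * q powi b = q powi (a + b)"
  by (rule power_int_add[symmetric]) simp

lemma qpoch_nonzero [simp]: "qpoch n \<noteq> 0"
proof -
  have "1 - q ^ j \<noteq> 0" if "1 \<le> j" for j
  proof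
    assume "1 - q ^ j = 0"
    then have "fls_nth (1 - q ^ j) 0 = 0" by (simp only: fls_zero_nth)
    with that show False by simp
  qed
  then show ?thesis by (simp add: qpoch_def)
qed

lemma qpoch_0 [simp]: "qpoch 0 = 1"
  by (simp add: qpoch_def)

lemma qpoch_Suc: "qpoch (Suc n) = qpoch n * (1 - q ^ Suc n)"
  by (simp add: qpoch_def)

lemma qbinom_eq_0: "a < 0 \<or> n < a \<Longrightarrow> qbinom n a = 0"
  by (auto simp: qbinom_def)

lemma qbinom_0_right [simp]: "0 \<le> n \<Longrightarrow> qbinom n 0 = 1"
  by (simp add: qbinom_def)

lemma qbinom_self [simp]: "0 \<le> n \<Longrightarrow> qbinom n n = 1"
  by (simp add: qbinom_def)

lemma qbinom_sym: "qbinom n a = qbinom n (n - a)"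
  by (auto simp: qbinom_def mult.commute)

section \<open>The q-Pascal rule and the q-Vandermonde and q-Pfaff-Saalschuetz sums\<close>

lemma qbinom_pascal:
  assumes "0 \<le> n"
  shows "qbinom (n + 1) a = q powi a * qbinom n a + qbinom n (a - 1)"
proof -
  consider "a < 0 \<or> a > n + 1" | "a = 0" | "a = n + 1" | "1 \<le> a \<and> a \<le> n" by linarith
  then show ?thesis
  proof cases
    case 4
    define c d where "c = nat (a - 1)" and "d = nat (n - a)"
    have a: "a = int (Suc c)" and n: "n = int (c + d + 1)" using 4 by (simp_all add: c_def d_def)
    have 1: "qbinom (n + 1) a = qpoch (Suc (Suc (c + d))) / (qpoch (Suc c) * qpoch (Suc d))"
      "qbinom n a = qpoch (Suc (c + d)) / (qpoch (Suc c) * qpoch d)"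
      "qbinom n (a - 1) = qpoch (Suc (c + d)) / (qpoch c * qpoch (Suc d))"
      by (simp_all add: qbinom_def a n nat_add_distrib nat_diff_distrib flip: of_nat_Suc)
    have nz: "1 - q ^ Suc k \<noteq> 0" for k
      using qpoch_nonzero[of "Suc k"] unfolding qpoch_Suc by (metis mult_zero_right)
    have p: "q ^ Suc (Suc (c + d)) = q ^ Suc c * q ^ Suc d" by (simp add: power_add)
    have powi_a: "q powi a = q ^ Suc c" unfolding a by (rule power_int_of_nat)
    \<comment> \<open>With x = q^(c+1) and y = q^(d+1) the rule rests on the splitting 1 - x y = x
      (1 - y) + (1 - x).\<close>
    have "(A * (1 - x * y)) / ((C * (1 - x)) * (D * (1 - y)))
        = x * (A / ((C * (1 - x)) * D)) + A / (C * (D * (1 - y)))"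
      if "1 - x \<noteq> 0" "1 - y \<noteq> 0" "C \<noteq> 0" "D \<noteq> 0" for A C D x y :: "'a :: field"
      using that by (simp add: divide_simps) (simp add: algebra_simps)
    from this[OF nz[of c] nz[of d] qpoch_nonzero qpoch_nonzero]
    show ?thesis
      unfolding 1 powi_a qpoch_Suc[of "Suc (c + d)"] qpoch_Suc[of c] qpoch_Suc[of d] p .
  qed (use assms in \<open>auto simp: qbinom_eq_0\<close>)
qed

text \<open>Induction on \<open>A\<close> by the Pascal rule for the first binomial. One of its two
  terms shifts the summation index, so the range is any finite set \<open>I\<close> containing
  \<open>{0..A}\<close>, a condition that survives the shift.\<close>

lemma q_vandermonde:
  assumes "0 \<le> A" and "0 \<le> B" and "finite I" and "{0..A} \<subseteq> I"
  shows "(\<Sum>i\<in>I. q powi ((A - i) * (h - i)) * qbinom A i * qbinom B (h - i)) = qbinom (A + B) h"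
  using assms
proof (induction A arbitrary: h I rule: int_ge_induct)
  case base
  have "(\<Sum>i\<in>I. q powi ((0 - i) * (h - i)) * qbinom 0 i * qbinom B (h - i))
      = (\<Sum>i\<in>{0}. q powi ((0 - i) * (h - i)) * qbinom 0 i * qbinom B (h - i))"
    using base by (intro sum.mono_neutral_right) (auto simp: qbinom_def)
  then show ?case by simp
next
  case (step A)
  have "(\<Sum>i\<in>I. q powi ((A + 1 - i) * (h - i)) * qbinom (A + 1) i * qbinom B (h - i))
      = (\<Sum>i\<in>I. q powi h * (q powi ((A - i) * (h - i)) * qbinom A i * qbinom B (h - i))
        + q powi ((A - (i - 1)) * (h - 1 - (i - 1))) * qbinom A (i - 1) * qbinom B (h - 1 - (i - 1)))"
  proof (rule sum.cong[OF refl])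
    fix i
    have 1: "q powi h * q powi ((A - i) * (h - i)) = q powi ((A + 1 - i) * (h - i)) * q powi i"
      unfolding qpow_mult by (rule arg_cong[where f="\<lambda>x. q powi x"]) (simp add: algebra_simps)
    show "q powi ((A + 1 - i) * (h - i)) * qbinom (A + 1) i * qbinom B (h - i) =
       q powi h * (q powi ((A - i) * (h - i)) * qbinom A i * qbinom B (h - i))
        + q powi ((A - (i - 1)) * (h - 1 - (i - 1))) * qbinom A (i - 1) * qbinom B (h - 1 - (i - 1))"
      unfolding qbinom_pascal[OF step.hyps(1)] mult.assoc[symmetric] 1
      by (simp add: algebra_simps)
  qed
  also have "\<dots> = q powi h * (\<Sum>i\<in>I. q powi ((A - i) * (h - i)) * qbinom A i * qbinom B (h - i))
      + (\<Sum>i\<in>(\<lambda>i. i - 1) ` I. q powi ((A - i) * (h - 1 - i)) * qbinom A i * qbinom B (h - 1 - i))"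
    unfolding sum.distrib sum_distrib_left by (subst sum.reindex) (auto simp: inj_on_def)
  also have "(\<Sum>i\<in>(\<lambda>i. i - 1) ` I. q powi ((A - i) * (h - 1 - i)) * qbinom A i * qbinom B (h - 1 - i))
      = qbinom (A + B) (h - 1)"
  proof (rule step.IH)
    show "{0..A} \<subseteq> (\<lambda>i. i - 1) ` I"
    proof
      fix x assume "x \<in> {0..A}"
      then have "x + 1 \<in> I" using step.prems by auto
      then show "x \<in> (\<lambda>i. i - 1) ` I" by (rule rev_image_eqI) simp
    qed
  qed (use step.prems in auto)
  also have "(\<Sum>i\<in>I. q powi ((A - i) * (h - i)) * qbinom A i * qbinom B (h - i)) = qbinom (A + B) h"
    by (rule step.IH) (use step.prems step.hyps in auto)
  also have "q powi h * qbinom (A + B) h + qbinom (A + B) (h - 1) = qbinom (A + 1 + B) h"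
    using qbinom_pascal[of "A + B" h] step by (simp add: ac_simps)
  finally show ?case .
qed

lemma q_vandermonde_shifted:
  assumes "0 \<le> m" and "0 \<le> n" and "finite I" and "{0..m} \<subseteq> I"
  shows "(\<Sum>k\<in>I. q powi (k * (k + c)) * qbinom m k * qbinom n (k + c)) = qbinom (m + n) (m + c)"
proof -
  have "(\<Sum>k\<in>I. q powi (k * (k + c)) * qbinom m k * qbinom n (k + c)) =
      (\<Sum>i\<in>(\<lambda>k. m - k) ` I. q powi ((m - i) * (m + c - i)) * qbinom m i * qbinom n (m + c - i))"
  proof (subst sum.reindex)
    have e: "m - (m - k) = k" "m + c - (m - k) = k + c" for k by simp_all
    show "(\<Sum>k\<in>I. q powi (k * (k + c)) * qbinom m k * qbinom n (k + c)) =
      sum ((\<lambda>i. q powi ((m - i) * (m + c - i)) * qbinom m i * qbinom n (m + c - i)) \<circ> (\<lambda>k. m - k)) I"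
      unfolding comp_def e qbinom_sym[of m "m - _"] by (rule refl)
  qed (auto simp: inj_on_def)
  also have "\<dots> = qbinom (m + n) (m + c)"
  proof (rule q_vandermonde)
    show "{0..m} \<subseteq> (\<lambda>k. m - k) ` I"
    proof
      fix x assume "x \<in> {0..m}"
      then have "m - x \<in> I" using assms by auto
      then show "x \<in> (\<lambda>k. m - k) ` I" by (rule rev_image_eqI) simp
    qed
  qed (use assms in auto)
  finally show ?thesis .
qed

text \<open>Inside the ranges both sides are (q)_m / ((q)_k (q)_(j-k) (q)_(m-j)); outside both
  vanish.\<close>

lemma qbinom_trinomial_revision:
  "qbinom m k * qbinom (m - k) (j - k) = qbinom m j * qbinom j k"
proof (cases "0 \<le> k \<and> k \<le> j \<and> j \<le> m")
  case True
  then show ?thesis by (simp add: qbinom_def)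
qed (auto simp: qbinom_def)

text \<open>The last binomial is expanded by q-Vandermonde over \<open>j\<close>, and trinomial
  revision moves \<open>k\<close> into \<open>qbinom j k\<close>. The sum over \<open>k\<close> is
  then a q-Vandermonde sum. A second revision pulls out \<open>qbinom (n + y) (y + c)\<close> and
  leaves one more q-Vandermonde sum, over \<open>j\<close>.\<close>

lemma q_pfaff_saalschuetz:
  assumes mn: "0 \<le> m" "0 \<le> n" and I: "finite I" "{0..m} \<subseteq> I"
  shows "(\<Sum>k\<in>I. q powi (k * (k + c)) * qbinom m k * qbinom n (k + c) * qbinom (m + n + y - k) (m + n))
    = qbinom (m + y + c) y * qbinom (n + y) (y + c)"
proof (cases "0 \<le> y \<and> 0 \<le> y + c")
  case False
  have "q powi (k * (k + c)) * qbinom m k * qbinom n (k + c) * qbinom (m + n + y - k) (m + n) = 0" for k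
    using False by (auto simp: qbinom_def)
  then have "(\<Sum>k\<in>I. q powi (k * (k + c)) * qbinom m k * qbinom n (k + c) * qbinom (m + n + y - k) (m + n)) = 0"
    by (intro sum.neutral) auto
  then show ?thesis using False by (auto simp: qbinom_def)
next
  case y: True
  define J where "J = {0..m}"
  have J: "finite J" "J \<subseteq> I" using I by (auto simp: J_def)
  have "(\<Sum>k\<in>I. q powi (k * (k + c)) * qbinom m k * qbinom n (k + c) * qbinom (m + n + y - k) (m + n))
    = (\<Sum>k\<in>J. q powi (k * (k + c)) * qbinom m k * qbinom n (k + c) * qbinom (m + n + y - k) (m + n))"
    using I J by (intro sum.mono_neutral_right) (auto simp: qbinom_def J_def)
  also have "\<dots> = (\<Sum>k\<in>J. \<Sum>j\<in>J. q powi ((m - j) * (y - j)) * qbinom m j * qbinom (n + y) (y - j) *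
      (q powi (k * (k + c)) * qbinom j k * qbinom n (k + c)))"
  proof (rule sum.cong[OF refl])
    fix k assume "k \<in> J"
    then have k: "0 \<le> k" "k \<le> m" by (auto simp: J_def)
    have "qbinom (m + n + y - k) (m + n) = qbinom ((m - k) + (n + y)) (y - k)"
      by (subst qbinom_sym) (simp add: algebra_simps)
    also have "\<dots> = (\<Sum>i\<in>(\<lambda>j. j - k) ` J. q powi ((m - k - i) * (y - k - i)) * qbinom (m - k) i * qbinom (n + y) (y - k - i))"
    proof (rule q_vandermonde[symmetric])
      show "{0..m - k} \<subseteq> (\<lambda>j. j - k) ` J"
      proof
        fix x assume "x \<in> {0..m - k}"
        then have "x + k \<in> J" using k by (auto simp: J_def)
        then show "x \<in> (\<lambda>j. j - k) ` J" by (rule rev_image_eqI) simp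
      qed
    qed (use k mn y J in auto)
    also have "\<dots> = (\<Sum>j\<in>J. q powi ((m - j) * (y - j)) * qbinom (m - k) (j - k) * qbinom (n + y) (y - j))"
      by (subst sum.reindex) (auto simp: inj_on_def)
    finally have "q powi (k * (k + c)) * qbinom m k * qbinom n (k + c) * qbinom (m + n + y - k) (m + n)
      = (\<Sum>j\<in>J. q powi ((m - j) * (y - j)) * (qbinom m k * qbinom (m - k) (j - k)) * qbinom (n + y) (y - j) *
          (q powi (k * (k + c)) * qbinom n (k + c)))"
      by (simp add: sum_distrib_left mult_ac)
    then show "q powi (k * (k + c)) * qbinom m k * qbinom n (k + c) * qbinom (m + n + y - k) (m + n)
      = (\<Sum>j\<in>J. q powi ((m - j) * (y - j)) * qbinom m j * qbinom (n + y) (y - j) *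
          (q powi (k * (k + c)) * qbinom j k * qbinom n (k + c)))"
      by (simp only: qbinom_trinomial_revision mult_ac)
  qed
  also have "\<dots> = (\<Sum>j\<in>J. q powi ((m - j) * (y - j)) * qbinom m j * qbinom (n + y) (y - j) *
      (\<Sum>k\<in>J. q powi (k * (k + c)) * qbinom j k * qbinom n (k + c)))"
    by (subst sum.swap) (simp add: sum_distrib_left)
  also have "\<dots> = (\<Sum>j\<in>J. q powi ((m - j) * (y - j)) * qbinom m j * (qbinom (n + y) (y - j) * qbinom (j + n) (j + c)))"
    using mn by (intro sum.cong refl, subst q_vandermonde_shifted) (auto simp: J_def)
  also have "\<dots> = (\<Sum>j\<in>J. q powi ((m - j) * (y - j)) * qbinom m j * (qbinom (n + y) (y + c) * qbinom (y + c) (y - j)))"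
  proof (rule sum.cong[OF refl])
    fix j assume "j \<in> J"
    then have "qbinom (n + y) (y - j) * qbinom (j + n) (j + c) = qbinom (n + y) (y + c) * qbinom (y + c) (y - j)"
      using qbinom_trinomial_revision[of "n + y" "y - j" "y + c"] by (simp add: algebra_simps)
    then show "q powi ((m - j) * (y - j)) * qbinom m j * (qbinom (n + y) (y - j) * qbinom (j + n) (j + c))
      = q powi ((m - j) * (y - j)) * qbinom m j * (qbinom (n + y) (y + c) * qbinom (y + c) (y - j))"
      by simp
  qed
  also have "\<dots> = qbinom (n + y) (y + c) * (\<Sum>j\<in>J. q powi ((m - j) * (y - j)) * qbinom m j * qbinom (y + c) (y - j))"
    by (simp add: sum_distrib_left mult_ac)
  also have "(\<Sum>j\<in>J. q powi ((m - j) * (y - j)) * qbinom m j * qbinom (y + c) (y - j)) = qbinom (m + (y + c)) y"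
    using mn y by (intro q_vandermonde) (auto simp: J_def)
  finally show ?thesis by (simp add: mult.commute add.assoc)
qed

section \<open>The Burge transform of products of two q-binomials\<close>

definition burge_binom :: "int \<Rightarrow> int \<Rightarrow> int \<Rightarrow> int \<Rightarrow> rat fls" where
  "burge_binom L M a b = qbinom (L + M + a - b) (L + a) * qbinom (L + M - a + b) (L - a)"

lemma burge_binom_nonzeroD:
  assumes "burge_binom L M a b \<noteq> 0"
  shows "\<bar>a\<bar> \<le> L" and "\<bar>b\<bar> \<le> M"
  using assms by (auto simp: burge_binom_def qbinom_def split: if_splits)

lemma burge_binom_swap: "burge_binom L M a b = burge_binom M L b a"
  unfolding burge_binom_def
  by (subst qbinom_sym, subst (2) qbinom_sym) (simp add: algebra_simps)

lemma burge_binom_minus: "burge_binom L M (- a) (- b) = burge_binom L M a b"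
  by (simp add: burge_binom_def mult.commute)

text \<open>Complementing both lower entries leaves \<open>i\<close> only in the lower entries,
  which is the shape of the first two binomials in \<open>q_pfaff_saalschuetz\<close>.\<close>

lemma burge_transform_summand:
  "burge_binom (L - i) i a b = qbinom (L + a - b) (i - b) * qbinom (L - a + b) (i + b)"
  unfolding burge_binom_def by (subst qbinom_sym, subst (2) qbinom_sym) (simp add: algebra_simps)

text \<open>
  The sign condition excludes \<open>\<bar>a + b\<bar> \<le> L < \<bar>a - b\<bar>\<close>, where the left-hand sides vanish but the
  right-hand sides need not.
\<close>

lemma burge_transform:
  assumes "0 \<le> a * b" and "finite I" and "{0..L} \<subseteq> I"
  shows "(\<Sum>i\<in>I. q powi (i * i) * qbinom (2 * L + M - i) (2 * L) * burge_binom (L - i) i a b)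
    = q powi (b * b) * burge_binom L M (a + b) b"
    and "(\<Sum>i\<in>I. q powi (i * i) * burge_binom (L - i) i a b) = q powi (b * b) * qbinom (2 * L) (L + a + b)"
proof -
  consider "\<bar>a - b\<bar> \<le> L" | "L < \<bar>a - b\<bar>" by linarith
  then have "(\<Sum>i\<in>I. q powi (i * i) * qbinom (2 * L + M - i) (2 * L) * burge_binom (L - i) i a b)
      = q powi (b * b) * burge_binom L M (a + b) b \<and>
    (\<Sum>i\<in>I. q powi (i * i) * burge_binom (L - i) i a b) = q powi (b * b) * qbinom (2 * L) (L + a + b)"
  proof cases
    case 1
    \<comment> \<open>With k = i - b the summand takes the form of
      \<open>q_pfaff_saalschuetz\<close> for these \<open>m\<close> and \<open>n\<close> and for c =
      2 b.\<close>
    define m n where "m = L + a - b" and "n = L - a + b"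
    have mn: "0 \<le> m" "0 \<le> n" "m + n = 2 * L" using 1 by (auto simp: m_def n_def)
    \<comment> \<open>The evaluations want an index set containing \<open>{0..m}\<close>; the points
      added to the shifted \<open>I\<close> contribute 0.\<close>
    let ?I = "(\<lambda>i. i - b) ` I \<union> {0..m}"
    \<comment> \<open>The factor \<open>f\<close> covers both claims: it is the binomial containing
      \<open>M\<close> for the first and 1 for the second.\<close>
    have red: "(\<Sum>i\<in>I. q powi (i * i) * f i * burge_binom (L - i) i a b)
        = q powi (b * b) * (\<Sum>k\<in>?I. q powi (k * (k + 2 * b)) * qbinom m k * qbinom n (k + 2 * b) * f (k + b))" for f
    proof -
      have "(\<Sum>i\<in>I. q powi (i * i) * f i * burge_binom (L - i) i a b)
          = (\<Sum>i\<in>I. q powi (b * b) * (q powi ((i - b) * ((i - b) + 2 * b)) * qbinom m (i - b) * qbinom n ((i - b) + 2 * b) * f ((i - b) + b)))"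
      proof (rule sum.cong[OF refl])
        fix i
        have e: "(i - b) + 2 * b = i + b" "(i - b) + b = i" by simp_all
        have "q powi (i * i) = q powi (b * b) * q powi ((i - b) * (i + b))"
          unfolding qpow_mult by (rule arg_cong[where f="\<lambda>x. q powi x"]) (simp add: algebra_simps)
        then show "q powi (i * i) * f i * burge_binom (L - i) i a b
          = q powi (b * b) * (q powi ((i - b) * ((i - b) + 2 * b)) * qbinom m (i - b) * qbinom n ((i - b) + 2 * b) * f ((i - b) + b))"
          unfolding e burge_transform_summand m_def n_def by (simp only: mult_ac)
      qed
      also have "\<dots> = (\<Sum>k\<in>(\<lambda>i. i - b) ` I. q powi (b * b) * (q powi (k * (k + 2 * b)) * qbinom m k * qbinom n (k + 2 * b) * f (k + b)))"
        by (subst sum.reindex) (auto simp: inj_on_def)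
      also have "\<dots> = (\<Sum>k\<in>?I. q powi (b * b) * (q powi (k * (k + 2 * b)) * qbinom m k * qbinom n (k + 2 * b) * f (k + b)))"
      proof (rule sum.mono_neutral_left)
        show "\<forall>k\<in>?I - (\<lambda>i. i - b) ` I. q powi (b * b) * (q powi (k * (k + 2 * b)) * qbinom m k * qbinom n (k + 2 * b) * f (k + b)) = 0"
        proof
          fix k assume k: "k \<in> ?I - (\<lambda>i. i - b) ` I"
          then have "k + b \<notin> I" by (metis DiffD2 add_diff_cancel_right' image_eqI)
          \<comment> \<open>The lower entries add up to 2 (k + b) and the upper ones to 2 L, so one
            of the two binomials is out of range.\<close>
          then have "k + b < 0 \<or> L < k + b" using assms(3) by (meson atLeastAtMost_iff linorder_not_less subsetD)
          then have "qbinom m k * qbinom n (k + 2 * b) = 0"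
            by (auto simp: qbinom_def m_def n_def)
          then show "q powi (b * b) * (q powi (k * (k + 2 * b)) * qbinom m k * qbinom n (k + 2 * b) * f (k + b)) = 0"
            by auto
        qed
      qed (use assms in auto)
      finally show ?thesis by (simp add: sum_distrib_left)
    qed
    have I: "finite ?I" "{0..m} \<subseteq> ?I" using assms by auto
    have e: "qbinom (2 * L + M - (k + b)) (2 * L) = qbinom (m + n + (M - b) - k) (m + n)" for k
      by (rule arg_cong2[where f = qbinom]) (use mn in auto)
    have "(\<Sum>k\<in>?I. q powi (k * (k + 2 * b)) * qbinom m k * qbinom n (k + 2 * b) * qbinom (2 * L + M - (k + b)) (2 * L))
        = qbinom (m + (M - b) + 2 * b) (M - b) * qbinom (n + (M - b)) (M - b + 2 * b)"
      unfolding e by (rule q_pfaff_saalschuetz[OF mn(1,2) I])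
    also have "\<dots> = burge_binom L M (a + b) b"
      unfolding burge_binom_def m_def n_def
      by (subst qbinom_sym, subst (2) qbinom_sym) (simp add: algebra_simps)
    finally have A: "(\<Sum>k\<in>?I. q powi (k * (k + 2 * b)) * qbinom m k * qbinom n (k + 2 * b) * qbinom (2 * L + M - (k + b)) (2 * L))
        = burge_binom L M (a + b) b" .
    have B: "(\<Sum>k\<in>?I. q powi (k * (k + 2 * b)) * qbinom m k * qbinom n (k + 2 * b)) = qbinom (2 * L) (L + a + b)"
      using q_vandermonde_shifted[OF mn(1,2) I, of "2 * b"] mn(3) by (simp add: m_def algebra_simps)
    show ?thesis
      using red[of "\<lambda>i. qbinom (2 * L + M - i) (2 * L)"] red[of "\<lambda>_. 1"] unfolding A mult_1_right B by blast
  next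
    case 2
    have "\<bar>a - b\<bar> \<le> \<bar>a + b\<bar>" using assms(1) by (auto simp: zero_le_mult_iff)
    then have "L < \<bar>a + b\<bar>" using 2 by linarith
    then have "burge_binom L M (a + b) b = 0" "qbinom (2 * L) (L + a + b) = 0"
      using burge_binom_nonzeroD(1)[of L M "a + b" b] by (auto simp: qbinom_def)
    moreover have "burge_binom (L - i) i a b = 0" for i
      unfolding burge_transform_summand using 2 by (auto simp: qbinom_def)
    ultimately show ?thesis by simp
  qed
  then show "(\<Sum>i\<in>I. q powi (i * i) * qbinom (2 * L + M - i) (2 * L) * burge_binom (L - i) i a b)
      = q powi (b * b) * burge_binom L M (a + b) b"
    and "(\<Sum>i\<in>I. q powi (i * i) * burge_binom (L - i) i a b) = q powi (b * b) * qbinom (2 * L) (L + a + b)"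
    by auto
qed


subsection \<open>Bosonic sums\<close>

lemma bij_betw_Collect_preimage:
  "bij_betw h A B \<Longrightarrow> bij_betw h {x \<in> A. P (h x)} {y \<in> B. P y}"
  by (auto simp: bij_betw_def inj_on_def)

text \<open>A bijection matches the two supports, so the default value 0 of \<open>sum'\<close> for
  infinite support occurs on both sides or on neither.\<close>

lemma sum'_reindex_bij_betw:
  assumes "bij_betw h A B"
  shows "sum' (\<lambda>x. f (h x)) A = sum' f B"
proof -
  have bij: "bij_betw h {x \<in> A. f (h x) \<noteq> 0} {y \<in> B. f y \<noteq> 0}"
    by (rule bij_betw_Collect_preimage[OF assms])
  show ?thesis
    unfolding sum.G_def bij_betw_finite[OF bij] sum.reindex_bij_betw[OF bij] ..
qed

lemma sum'_diff:
  assumes "finite {x \<in> A. f x \<noteq> 0}" and "finite {x \<in> A. g x \<noteq> 0}"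
  shows "sum' (\<lambda>x. f x - g x) A = sum' f A - (sum' g A :: 'a :: ab_group_add)"
proof -
  have "sum' (\<lambda>x. (f x - g x) + g x) A = sum' (\<lambda>x. f x - g x) A + sum' g A"
  proof (rule sum.distrib'[OF _ assms(2)])
    show "finite {x \<in> A. f x - g x \<noteq> 0}"
      by (rule finite_subset[OF _ finite_UnI[OF assms]]) auto
  qed
  then show ?thesis by simp
qed

text \<open>For \<open>f = burge_binom L M\<close> this is F_{P,Q}(L, M). The function is a
  parameter because q-binomials and q-trinomials take its place in the last two transforms.\<close>

definition bosonic_sum :: "int \<Rightarrow> int \<Rightarrow> int \<Rightarrow> int \<Rightarrow> (int \<Rightarrow> int \<Rightarrow> rat fls) \<Rightarrow> rat fls" where
  "bosonic_sum P Q r s f = sum' (\<lambda>j. q powi (j * (Q * P * j + 1)) * f (Q * j) (P * j)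
     - q powi ((Q * j + s) * (P * j + r)) * f (Q * j + s) (P * j + r)) UNIV"

lemma bosonic_sum_swap: "bosonic_sum P Q r s f = bosonic_sum Q P s r (\<lambda>a b. f b a)"
  by (simp add: bosonic_sum_def mult.commute)

text \<open>A fixed finite range makes it possible to interchange the sum over \<open>j\<close> with
  the sum of a transform. A bound on one argument of \<open>f\<close> is enough: |C j + t| \<le> N
  with an integer C > 0 bounds |j| by N + |t|. The q-binomials and q-trinomials inserted later
  depend on one argument only.\<close>

lemma bosonic_sum_eq_sum:
  assumes PQ: "0 < P" "0 < Q" and f: "\<And>a b. f a b \<noteq> 0 \<Longrightarrow> \<bar>a\<bar> \<le> N \<or> \<bar>b\<bar> \<le> N"
    and J: "finite J" "{- (N + \<bar>r\<bar> + \<bar>s\<bar>)..N + \<bar>r\<bar> + \<bar>s\<bar>} \<subseteq> J"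
  shows "bosonic_sum P Q r s f = (\<Sum>j\<in>J. q powi (j * (Q * P * j + 1)) * f (Q * j) (P * j)
     - q powi ((Q * j + s) * (P * j + r)) * f (Q * j + s) (P * j + r))"
  unfolding bosonic_sum_def
proof (rule sum'_eq_sum[OF J(1)])
  have *: "\<bar>j\<bar> \<le> N + \<bar>r\<bar> + \<bar>s\<bar>" if "\<bar>C * j + t\<bar> \<le> N" "\<bar>t\<bar> \<le> \<bar>r\<bar> + \<bar>s\<bar>" "0 < C" for C t j
  proof -
    have "1 * \<bar>j\<bar> \<le> C * \<bar>j\<bar>" using that by (intro mult_right_mono) auto
    then have "\<bar>j\<bar> \<le> \<bar>C * j\<bar>" using that by (simp add: abs_mult)
    with that show ?thesis by linarith
  qed
  fix j assume "q powi (j * (Q * P * j + 1)) * f (Q * j) (P * j)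
     - q powi ((Q * j + s) * (P * j + r)) * f (Q * j + s) (P * j + r) \<noteq> 0"
  then have "f (Q * j) (P * j) \<noteq> 0 \<or> f (Q * j + s) (P * j + r) \<noteq> 0"
    by auto
  then have "\<bar>Q * j + 0\<bar> \<le> N \<or> \<bar>P * j + 0\<bar> \<le> N \<or> \<bar>Q * j + s\<bar> \<le> N \<or> \<bar>P * j + r\<bar> \<le> N"
    using f by fastforce
  then have "\<bar>j\<bar> \<le> N + \<bar>r\<bar> + \<bar>s\<bar>"
    using *[of Q j 0] *[of P j 0] *[of Q j s] *[of P j r] PQ by auto
  then have "j \<in> {- (N + \<bar>r\<bar> + \<bar>s\<bar>)..N + \<bar>r\<bar> + \<bar>s\<bar>}" by auto
  then show "j \<in> J" using J(2) by blast
qed auto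

text \<open>This supplies the sign condition of the Burge transform for all terms of a bosonic sum.\<close>

lemma nonneg_mult_if_det_small:
  fixes a b P Q :: int
  assumes "0 < P" "0 < Q" and "\<bar>a * P - b * Q\<bar> \<le> 1"
  shows "0 \<le> a * b"
proof (rule ccontr)
  assume "\<not> 0 \<le> a * b"
  then consider "0 < a" "b < 0" | "a < 0" "0 < b"
    by (auto simp: zero_le_mult_iff not_le mult_less_0_iff)
  then show False
  proof cases
    case 1
    then have "0 < a * P" "b * Q < 0" using assms by (auto simp: mult_pos_pos mult_neg_pos)
    with assms show False by linarith
  next
    case 2
    then have "a * P < 0" "0 < b * Q" using assms by (auto simp: mult_pos_pos mult_neg_pos)
    with assms show False by linarith
  qed
qed

text \<open>The transform \<open>tr\<close> acts term by term with b = P j or b = P j + r. Its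
  factor q^(b^2) turns the exponent a b into (a + b) b, so (Q, s) becomes (Q + P, s + r). By the
  determinant condition a P - b Q is 0 or of absolute value 1, which yields the sign
  condition.\<close>

lemma bosonic_sum_transform:
  assumes PQ: "0 < P" "0 < Q" and rs: "\<bar>Q * r - P * s\<bar> = 1"
    and f: "\<And>i a b. i \<in> I \<Longrightarrow> f i a b \<noteq> 0 \<Longrightarrow> \<bar>a\<bar> \<le> N \<or> \<bar>b\<bar> \<le> N"
    and h: "\<And>a b. h a b \<noteq> 0 \<Longrightarrow> \<bar>a\<bar> \<le> N \<or> \<bar>b\<bar> \<le> N"
    and tr: "\<And>a b. 0 \<le> a * b \<Longrightarrow> (\<Sum>i\<in>I. c i * f i a b) = q powi (b * b) * h (a + b) b"
  shows "(\<Sum>i\<in>I. c i * bosonic_sum P Q r s (f i)) = bosonic_sum P (Q + P) r (s + r) h"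
proof -
  \<comment> \<open>Large enough for both \<open>s\<close> and \<open>s + r\<close>, so that both
    sides are summed over the same \<open>J\<close>.\<close>
  define K where "K = \<bar>N\<bar> + 2 * \<bar>r\<bar> + \<bar>s\<bar>"
  define J where "J = {- K..K}"
  have J: "finite J" "{- (N + \<bar>r\<bar> + \<bar>s\<bar>)..N + \<bar>r\<bar> + \<bar>s\<bar>} \<subseteq> J"
    "{- (N + \<bar>r\<bar> + \<bar>s + r\<bar>)..N + \<bar>r\<bar> + \<bar>s + r\<bar>} \<subseteq> J"
    by (auto simp: J_def K_def)
  have "(\<Sum>i\<in>I. c i * bosonic_sum P Q r s (f i))
      = (\<Sum>i\<in>I. \<Sum>j\<in>J. q powi (j * (Q * P * j + 1)) * (c i * f i (Q * j) (P * j))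
         - q powi ((Q * j + s) * (P * j + r)) * (c i * f i (Q * j + s) (P * j + r)))"
  proof (rule sum.cong[OF refl])
    fix i assume "i \<in> I"
    then have "bosonic_sum P Q r s (f i) = (\<Sum>j\<in>J. q powi (j * (Q * P * j + 1)) * f i (Q * j) (P * j)
         - q powi ((Q * j + s) * (P * j + r)) * f i (Q * j + s) (P * j + r))"
      by (intro bosonic_sum_eq_sum[OF PQ f J(1,2)])
    then show "c i * bosonic_sum P Q r s (f i) = (\<Sum>j\<in>J. q powi (j * (Q * P * j + 1)) * (c i * f i (Q * j) (P * j))
         - q powi ((Q * j + s) * (P * j + r)) * (c i * f i (Q * j + s) (P * j + r)))"
      by (simp only: sum_distrib_left right_diff_distrib mult.left_commute)
  qed
  also have "\<dots> = (\<Sum>j\<in>J. q powi (j * (Q * P * j + 1)) * (\<Sum>i\<in>I. c i * f i (Q * j) (P * j))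
         - q powi ((Q * j + s) * (P * j + r)) * (\<Sum>i\<in>I. c i * f i (Q * j + s) (P * j + r)))"
    by (subst sum.swap) (simp only: sum_subtractf sum_distrib_left)
  also have "\<dots> = (\<Sum>j\<in>J. q powi (j * ((Q + P) * P * j + 1)) * h ((Q + P) * j) (P * j)
         - q powi (((Q + P) * j + (s + r)) * (P * j + r)) * h ((Q + P) * j + (s + r)) (P * j + r))"
  proof (rule sum.cong[OF refl])
    fix j
    have 1: "0 \<le> (Q * j) * (P * j)"
      using PQ by (intro nonneg_mult_if_det_small[OF PQ]) simp
    have "(Q * j + s) * P - (P * j + r) * Q = - (Q * r - P * s)" by (simp add: algebra_simps)
    then have 2: "0 \<le> (Q * j + s) * (P * j + r)"
      using rs by (intro nonneg_mult_if_det_small[OF PQ]) simp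
    have e: "Q * j + P * j = (Q + P) * j" "Q * j + s + (P * j + r) = (Q + P) * j + (s + r)"
      "j * (Q * P * j + 1) + P * j * (P * j) = j * ((Q + P) * P * j + 1)"
      "(Q * j + s) * (P * j + r) + (P * j + r) * (P * j + r) = ((Q + P) * j + (s + r)) * (P * j + r)"
      by (simp_all add: algebra_simps)
    show "q powi (j * (Q * P * j + 1)) * (\<Sum>i\<in>I. c i * f i (Q * j) (P * j))
         - q powi ((Q * j + s) * (P * j + r)) * (\<Sum>i\<in>I. c i * f i (Q * j + s) (P * j + r))
       = q powi (j * ((Q + P) * P * j + 1)) * h ((Q + P) * j) (P * j)
         - q powi (((Q + P) * j + (s + r)) * (P * j + r)) * h ((Q + P) * j + (s + r)) (P * j + r)"
      unfolding tr[OF 1] tr[OF 2] mult.assoc[symmetric, of "q powi _"] qpow_mult e ..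
  qed
  also have "\<dots> = bosonic_sum P (Q + P) r (s + r) h"
    by (rule bosonic_sum_eq_sum[symmetric, OF _ _ h J(1,3)]) (use PQ in auto)
  finally show ?thesis .
qed

text \<open>The starting value of the Burge recursion, obtained by telescoping.\<close>

lemma bosonic_sum_1_1:
  assumes rs: "\<bar>r - s\<bar> = 1" and LM: "0 \<le> L" "0 \<le> M"
  shows "bosonic_sum 1 1 r s (burge_binom L M) = of_bool (L = 0 \<and> M = 0)"
proof -
  define u v where "u j = q powi (j * (j + 1)) * burge_binom L M j j"
    and "v j = q powi ((j + 1) * j) * burge_binom L M (j + 1) j" for j
  have fin: "finite {j \<in> UNIV. C j * burge_binom L M (x j) (j + t) \<noteq> 0}" for C x t
    by (rule finite_subset[of _ "{- M - t..M - t}"]) (auto dest!: burge_binom_nonzeroD(2))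
  have fin_u: "finite {j \<in> UNIV. u j \<noteq> 0}" and fin_v: "finite {j \<in> UNIV. v j \<noteq> 0}"
    using fin[of "\<lambda>j. q powi (j * (j + 1))" "\<lambda>j. j" 0] fin[of "\<lambda>j. q powi ((j + 1) * j)" "\<lambda>j. j + 1" 0]
    by (simp_all only: u_def v_def add_0_right)
  have "bosonic_sum 1 1 r s (burge_binom L M)
      = sum' (\<lambda>j. u j - q powi ((j + s) * (j + r)) * burge_binom L M (j + s) (j + r)) UNIV"
    by (simp only: bosonic_sum_def u_def mult_1)
  also have "\<dots> = sum' u UNIV - sum' (\<lambda>j. q powi ((j + s) * (j + r)) * burge_binom L M (j + s) (j + r)) UNIV"
    by (rule sum'_diff[OF fin_u fin])
  also have "sum' (\<lambda>j. q powi ((j + s) * (j + r)) * burge_binom L M (j + s) (j + r)) UNIV = sum' v UNIV"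
  proof -
    \<comment> \<open>The first case is a shift of \<open>j\<close>, the second a reflection
      combined with \<open>burge_binom_minus\<close>.\<close>
    consider "s = r + 1" | "s = r - 1" using rs by linarith
    then show ?thesis
    proof cases
      case 1
      have "bij_betw (\<lambda>j. j + r) UNIV UNIV"
        by (rule bij_betw_byWitness[of _ "\<lambda>j. j - r"]) auto
      from sum'_reindex_bij_betw[OF this, of v] show ?thesis
        by (simp only: v_def 1 add.assoc)
    next
      case 2
      have "bij_betw (\<lambda>j. - j - r) UNIV UNIV"
        by (rule bij_betw_byWitness[of _ "\<lambda>j. - j - r"]) auto
      moreover have "v (- j - r) = q powi ((j + s) * (j + r)) * burge_binom L M (j + s) (j + r)" for j
      proof -
        have "- j - r + 1 = - (j + s)" "- j - r = - (j + r)" using 2 by auto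
        then show ?thesis by (simp only: v_def burge_binom_minus minus_mult_minus)
      qed
      ultimately show ?thesis using sum'_reindex_bij_betw[of "\<lambda>j. - j - r" UNIV UNIV v] by simp
    qed
  qed
  also have "sum' u UNIV - sum' v UNIV = of_bool (L = 0 \<and> M = 0)"
  proof (cases "L = 0 \<and> M = 0")
    case True
    have "sum' u UNIV = sum u {0}"
      using True by (intro sum'_eq_sum) (auto simp: u_def dest: burge_binom_nonzeroD)
    moreover have "sum' v UNIV = sum v {}"
      using True by (intro sum'_eq_sum) (auto simp: v_def burge_binom_def qbinom_def split: if_splits)
    ultimately show ?thesis using True by (simp add: u_def burge_binom_def)
  next
    case False
    define A where "A = L + M"
    have A: "0 \<le> A - 1" "0 \<le> A" using False LM by (auto simp: A_def)
    \<comment> \<open>The Pascal rule for the second factor of \<open>u j\<close> and for the first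
      factor of \<open>v j\<close> produces \<open>g j\<close> and \<open>g (j + 1)\<close>. The
      other two terms agree and cancel: both are q^(j(j+1)) [A; L+j] [A-1; L-j-1]. The rule for A -
      1 requires A \<ge> 1, hence the separate case L = M = 0.\<close>
    define g where "g j = q powi (L + j * j) * qbinom A (L + j) * qbinom (A - 1) (L - j)" for j
    have fin_g: "finite {j \<in> UNIV. g (j + t) \<noteq> 0}" for t
      by (rule finite_subset[of _ "{- L - t..L - t}"]) (auto simp: g_def qbinom_def split: if_splits)
    have tele: "u j - v j = g j - g (j + 1)" for j
    proof -
      have 1: "qbinom A (L - j) = q powi (L - j) * qbinom (A - 1) (L - j) + qbinom (A - 1) (L - j - 1)"
        using qbinom_pascal[OF A(1), of "L - j"] by simp
      have 2: "qbinom (A + 1) (L + j + 1) = q powi (L + j + 1) * qbinom A (L + j + 1) + qbinom A (L + j)"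
        using qbinom_pascal[OF A(2), of "L + j + 1"] by simp
      have 3: "q powi (L + j * j) = q powi (j * (j + 1)) * q powi (L - j)"
        "q powi (L + (j + 1) * (j + 1)) = q powi (j * (j + 1)) * q powi (L + j + 1)"
        unfolding qpow_mult by (rule arg_cong[where f="\<lambda>x. q powi x"], simp add: algebra_simps)+
      have 4: "burge_binom L M j j = qbinom A (L + j) * qbinom A (L - j)"
        "burge_binom L M (j + 1) j = qbinom (A + 1) (L + j + 1) * qbinom (A - 1) (L - j - 1)"
        "L - (j + 1) = L - j - 1" "L + (j + 1) = L + j + 1"
        by (simp_all add: burge_binom_def A_def algebra_simps)
      show ?thesis
        unfolding u_def v_def g_def 3 4 1 2 mult.commute[of "j + 1" j]
        by (simp only: ring_distribs mult_ac) simp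
    qed
    have "bij_betw (\<lambda>j. j + 1) (UNIV :: int set) UNIV"
      by (rule bij_betw_byWitness[of _ "\<lambda>j. j - 1"]) auto
    then have "sum' (\<lambda>j. g (j + 1)) UNIV = sum' g UNIV" by (rule sum'_reindex_bij_betw)
    moreover have "sum' u UNIV - sum' v UNIV = sum' g UNIV - sum' (\<lambda>j. g (j + 1)) UNIV"
      unfolding sum'_diff[OF fin_u fin_v, symmetric] tele
      using fin_g[of 0] fin_g[of 1] by (intro sum'_diff) simp_all
    ultimately show ?thesis using False by simp
  qed
  finally show ?thesis .
qed

section \<open>Nested sums driven by a list of flags\<close>

text \<open>
  The list has one flag for each row \<open>t\<close> of the matrix \<open>I'\<close>, which is \<open>True\<close> if \<open>t = t\<^sub>m\<close> for some \<open>m\<close>;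
  the first row of the list is reached with \<open>L = m\<^sub>t / 2\<close> and \<open>M = (m\<^sub>t\<^sub>-\<^sub>1 - m\<^sub>t) / 2\<close>, where \<open>m\<^sub>t\<close> is
  the summation variable of row \<open>t\<close>. The last row, \<open>t = d'\<close>, becomes a list of two flags.
\<close>

fun fermionic_chain :: "bool list \<Rightarrow> int \<Rightarrow> int \<Rightarrow> rat fls" where
  "fermionic_chain [] L M = of_bool (L = 0 \<and> M = 0)"
| "fermionic_chain (b # bs) L M = (\<Sum>k\<in>{0..L}.
     (if b then q powi (k * k) * qbinom (2 * L + M - k) (2 * L)
      else q powi ((L - k) * (L - k)) * qbinom (L + M + k) (2 * L)) * fermionic_chain bs k (L - k))"

text \<open>The value Q/P belonging to a list of flags: undoing a Burge transform subtracts 1 from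
  Q/P, and the flag \<open>True\<close> then exchanges P and Q.\<close>

fun chain_ratio :: "bool list \<Rightarrow> rat" where
  "chain_ratio [] = 1"
| "chain_ratio (b # bs) = 1 + (if b then 1 / chain_ratio bs else chain_ratio bs)"

lemma chain_ratio_pos: "0 < chain_ratio bs"
  by (induction bs) (auto intro: add_pos_pos)

text \<open>Lets the nested ranges \<open>{0..L}\<close> be enlarged to a common cut-off: a variable
  exceeding its predecessor makes the next \<open>M\<close> negative.\<close>

lemma fermionic_chain_neg: "M < 0 \<Longrightarrow> fermionic_chain bs L M = 0"
  by (cases bs) (auto simp: qbinom_def intro!: sum.neutral)

text \<open>The chain for \<open>[False]\<close> vanishes unless its first argument is 0, so only k
  = 0 survives. What remains is the factor of the last matrix row, with no further variable.\<close>

lemma fermionic_chain_terminal: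
  assumes "0 \<le> L"
  shows "fermionic_chain [e, False] L M = (if e then qbinom (2 * L + M) (2 * L) else q powi (L * L) * qbinom (L + M) (2 * L))"
proof -
  have 1: "fermionic_chain [False] k N = of_bool (k = 0 \<and> 0 \<le> N)" if "0 \<le> k" for k N
  proof -
    have "fermionic_chain [False] k N = (\<Sum>i\<in>{0..k}. if i = 0 then of_bool (k = 0 \<and> 0 \<le> N) else 0)"
      by (auto simp: qbinom_def intro!: sum.cong)
    then show ?thesis using that by simp
  qed
  have "fermionic_chain [e, False] L M = (\<Sum>k\<in>{0..L}. if k = 0 then (if e then qbinom (2 * L + M) (2 * L) else q powi (L * L) * qbinom (L + M) (2 * L)) else 0)"
    by (subst fermionic_chain.simps(2)) (auto simp: 1 simp del: fermionic_chain.simps intro!: sum.cong)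
  then show ?thesis using assms by simp
qed

lemma sum_reverse_atLeast0AtMost_int:
  "(\<Sum>k\<in>{0..L::int}. f k) = (\<Sum>i\<in>{0..L}. f (L - i))"
  by (rule sum.reindex_bij_witness[of _ "\<lambda>i. L - i" "\<lambda>i. L - i"]) auto

text \<open>Induction on the flags, each step undoing one Burge transform and, for
  \<open>True\<close>, applying the symmetry of \<open>burge_binom\<close>. The ratio keeps Q - P
  positive. For the empty list it gives Q = P, and the determinant condition makes P divide 1, so
  \<open>bosonic_sum_1_1\<close> applies.\<close>

lemma fermionic_chain_eq_bosonic_sum:
  assumes "0 < P" "0 < Q" and "\<bar>Q * r - P * s\<bar> = 1" and "of_int Q = chain_ratio bs * of_int P"
    and "0 \<le> L" "0 \<le> M"
  shows "fermionic_chain bs L M = bosonic_sum P Q r s (burge_binom L M)"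
  using assms
proof (induction bs arbitrary: P Q r s L M)
  case Nil
  then have QP: "Q = P" by simp
  then have "\<bar>P * (r - s)\<bar> = 1" using Nil by (simp add: algebra_simps)
  then have "P dvd 1" by (metis abs_dvd_iff dvd_triv_left dvd_abs_iff)
  then have "P = 1" using Nil by simp
  then show ?case using bosonic_sum_1_1[of r s L M] Nil QP by simp
next
  case (Cons b bs)
  let ?\<rho> = "chain_ratio bs"
  have \<rho>: "0 < ?\<rho>" by (rule chain_ratio_pos)
  have "of_int (Q - P) = (if b then 1 / ?\<rho> else ?\<rho>) * of_int P"
    using Cons.prems(4) by (simp add: algebra_simps split: if_splits)
  moreover from this have "0 < (of_int (Q - P) :: rat)"
    using \<rho> Cons.prems(1) by simp
  ultimately have QP: "0 < Q - P" and ratio: "of_int (Q - P) = (if b then 1 / ?\<rho> else ?\<rho>) * of_int P"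
    by (simp_all only: of_int_0_less_iff)
  have det: "\<bar>(Q - P) * r - P * (s - r)\<bar> = 1" "\<bar>P * (s - r) - (Q - P) * r\<bar> = 1"
    using Cons.prems(3) by (simp_all add: algebra_simps abs_minus_commute)
  have step: "bosonic_sum P Q r s (burge_binom L M) = (\<Sum>i\<in>{0..L}. q powi (i * i) * qbinom (2 * L + M - i) (2 * L)
      * bosonic_sum P (Q - P) r (s - r) (burge_binom (L - i) i))"
  proof -
    have "(\<Sum>i\<in>{0..L}. q powi (i * i) * qbinom (2 * L + M - i) (2 * L)
        * bosonic_sum P (Q - P) r (s - r) (burge_binom (L - i) i)) = bosonic_sum P (Q - P + P) r (s - r + r) (burge_binom L M)"
    proof (rule bosonic_sum_transform[where N = L, OF Cons.prems(1) QP det(1)])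
      show "(\<Sum>i\<in>{0..L}. q powi (i * i) * qbinom (2 * L + M - i) (2 * L) * burge_binom (L - i) i a b)
          = q powi (b * b) * burge_binom L M (a + b) b" if "0 \<le> a * b" for a b
        by (rule burge_transform(1)[OF that]) simp_all
    qed (auto dest: burge_binom_nonzeroD)
    then show ?thesis by simp
  qed
  show ?case
  proof (cases b)
    case True
    have r: "of_int P = ?\<rho> * of_int (Q - P)"
      unfolding ratio using True \<rho> by simp
    have "fermionic_chain bs k (L - k) = bosonic_sum P (Q - P) r (s - r) (burge_binom (L - k) k)"
      if "k \<in> {0..L}" for k
    proof -
      have "fermionic_chain bs k (L - k) = bosonic_sum (Q - P) P (s - r) r (burge_binom k (L - k))"
        using that by (intro Cons.IH QP Cons.prems det r) auto
      also have "\<dots> = bosonic_sum P (Q - P) r (s - r) (\<lambda>a b. burge_binom k (L - k) b a)"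
        by (rule bosonic_sum_swap)
      also have "(\<lambda>a b. burge_binom k (L - k) b a) = burge_binom (L - k) k"
        by (intro ext burge_binom_swap)
      finally show ?thesis .
    qed
    then show ?thesis unfolding step fermionic_chain.simps using True by (auto intro!: sum.cong)
  next
    case False
    have "fermionic_chain bs (L - i) i = bosonic_sum P (Q - P) r (s - r) (burge_binom (L - i) i)"
      if "i \<in> {0..L}" for i
      using that ratio False by (intro Cons.IH QP Cons.prems det) auto
    \<comment> \<open>In a row without a swap the chain variable is k = L - i, so the Burge sum is
      read backwards.\<close>
    moreover have "L - (L - i) = i" "L + M + (L - i) = 2 * L + M - i" for i by simp_all
    ultimately show ?thesis
      unfolding step fermionic_chain.simps by (subst sum_reverse_atLeast0AtMost_int) (simp add: False add_diff_eq)
  qed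
qed

section \<open>From q-binomials to q-trinomials\<close>

text \<open>Substitute k = N - a in the defining sum and merge its two binomials by trinomial
  revision. The exponents combine through a^2 + (N - a)(N + a) = N^2.\<close>

lemma qtrinom_eq_sum:
  assumes "L \<le> K"
  shows "(\<Sum>N\<in>{0..K}. q powi (N * N) * qbinom L (2 * N) * qbinom (2 * N) (N + a)) = q powi (a * a) * qtrinom L (2 * a)"
proof -
  let ?t = "\<lambda>k. q powi (k * (k + 2 * a)) * qbinom L k * qbinom (L - k) (k + 2 * a)"
  let ?u = "\<lambda>N. q powi ((N - a) * (N + a)) * (qbinom L (2 * N) * qbinom (2 * N) (N + a))"
  have t: "?t (N - a) = ?u N" for N
  proof -
    have "qbinom L (N - a) * qbinom (L - (N - a)) (2 * N - (N - a)) = qbinom L (2 * N) * qbinom (2 * N) (N - a)"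
      by (rule qbinom_trinomial_revision)
    moreover have "qbinom (2 * N) (N - a) = qbinom (2 * N) (N + a)"
      by (subst qbinom_sym) (simp add: algebra_simps)
    moreover have "2 * N - (N - a) = N + a" "N - a + 2 * a = N + a" by simp_all
    ultimately show ?thesis by (simp only: mult.assoc)
  qed
  have "bij_betw (\<lambda>N. N - a) {a..} {0..}"
    by (rule bij_betw_byWitness[of _ "\<lambda>k. k + a"]) auto
  from sum'_reindex_bij_betw[OF this, of ?t]
  have "qtrinom L (2 * a) = sum' ?u {a..}"
    unfolding qtrinom_def qtrinom_gen_def t ..
  also have "\<dots> = sum ?u {max 0 a..K}"
    using assms by (intro sum'_eq_sum) (auto dest!: qbinom_nonzeroD)
  also have "\<dots> = sum ?u {0..K}"
    by (rule sum.mono_neutral_left) (auto simp: qbinom_def)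
  finally have "q powi (a * a) * qtrinom L (2 * a) = (\<Sum>N\<in>{0..K}. q powi (a * a) * ?u N)"
    by (simp only: sum_distrib_left)
  moreover have "q powi (a * a) * ?u N = q powi (N * N) * qbinom L (2 * N) * qbinom (2 * N) (N + a)" for N
  proof -
    have "a * a + (N - a) * (N + a) = N * N" by (simp add: algebra_simps)
    then show ?thesis unfolding mult.assoc[symmetric] qpow_mult by simp
  qed
  ultimately show ?thesis by (simp only:)
qed

text \<open>The inner sum is a Burge transform in its second form; it leads from (P, Q - P) to (P,
  Q) and leaves the single binomial \<open>qbinom (2 * N) (N + a)\<close>. After exchanging the
  roles of P and Q, the sum over \<open>N\<close> is a further transform, which leads to P +
  Q.\<close>

lemma fermionic_chain_trinomial:
  assumes PQ: "0 < P" "P < Q" and rs: "\<bar>Q * r - P * s\<bar> = 1"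
    and ratio: "of_int (Q - P) = chain_ratio bs * of_int P" and K: "L \<le> K"
  shows "(\<Sum>N\<in>{0..K}. q powi (N * N) * qbinom L (2 * N) *
      (\<Sum>k\<in>{0..N}. q powi ((N - k) * (N - k)) * fermionic_chain bs k (N - k)))
    = bosonic_sum (P + Q) Q (r + s) s (\<lambda>a b. qtrinom L (2 * a))"
proof -
  have det: "\<bar>(Q - P) * r - P * (s - r)\<bar> = 1" "\<bar>P * s - Q * r\<bar> = 1"
    using rs by (simp_all add: algebra_simps abs_minus_commute)
  have inner: "(\<Sum>k\<in>{0..N}. q powi ((N - k) * (N - k)) * fermionic_chain bs k (N - k))
      = bosonic_sum Q P s r (\<lambda>b a. qbinom (2 * N) (N + a))" for N
  proof -
    have "(\<Sum>k\<in>{0..N}. q powi ((N - k) * (N - k)) * fermionic_chain bs k (N - k))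
        = (\<Sum>i\<in>{0..N}. q powi (i * i) * fermionic_chain bs (N - i) i)"
      by (subst sum_reverse_atLeast0AtMost_int) simp
    also have "\<dots> = (\<Sum>i\<in>{0..N}. q powi (i * i) * bosonic_sum P (Q - P) r (s - r) (burge_binom (N - i) i))"
      using PQ det ratio by (intro sum.cong refl arg_cong2[where f="(*)"] fermionic_chain_eq_bosonic_sum) auto
    also have "\<dots> = bosonic_sum P (Q - P + P) r (s - r + r) (\<lambda>a b. qbinom (2 * N) (N + a))"
    proof (rule bosonic_sum_transform[where N = N, OF PQ(1) _ det(1)])
      show "\<bar>a\<bar> \<le> N \<or> \<bar>b\<bar> \<le> N" if "i \<in> {0..N}" "burge_binom (N - i) i a b \<noteq> 0" for i a b
        using burge_binom_nonzeroD[OF that(2)] that(1) by simp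
      show "\<bar>a\<bar> \<le> N \<or> \<bar>b\<bar> \<le> N" if "qbinom (2 * N) (N + a) \<noteq> 0" for a b
        using qbinom_nonzeroD[OF that] by linarith
      fix a b :: int assume "0 \<le> a * b"
      then show "(\<Sum>i\<in>{0..N}. q powi (i * i) * burge_binom (N - i) i a b) = q powi (b * b) * qbinom (2 * N) (N + (a + b))"
        by (subst burge_transform(2)) (simp_all only: finite_atLeastAtMost_int order_refl add.assoc)
    qed (use PQ in simp)
    also have "\<dots> = bosonic_sum Q P s r (\<lambda>b a. qbinom (2 * N) (N + a))"
      by (simp only: bosonic_sum_swap[of P] diff_add_cancel)
    finally show ?thesis .
  qed
  have "(\<Sum>N\<in>{0..K}. q powi (N * N) * qbinom L (2 * N) * bosonic_sum Q P s r (\<lambda>b a. qbinom (2 * N) (N + a)))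
    = bosonic_sum Q (P + Q) s (r + s) (\<lambda>a b. qtrinom L (2 * b))"
  \<comment> \<open>Here \<open>h\<close> depends on its second argument only, so
    \<open>qtrinom_eq_sum\<close> has the form that \<open>tr\<close> demands.\<close>
  proof (rule bosonic_sum_transform[where N = "\<bar>K\<bar>", OF _ PQ(1) det(2) _ _ qtrinom_eq_sum[OF K]])
    show "\<bar>b\<bar> \<le> \<bar>K\<bar> \<or> \<bar>a\<bar> \<le> \<bar>K\<bar>" if "N \<in> {0..K}" "qbinom (2 * N) (N + a) \<noteq> 0" for N a b
      using qbinom_nonzeroD[OF that(2)] that(1) by auto
    show "\<bar>a\<bar> \<le> \<bar>K\<bar> \<or> \<bar>b\<bar> \<le> \<bar>K\<bar>" if "qtrinom L (2 * b) \<noteq> 0" for a b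
      using qtrinom_nonzeroD[OF that] K by linarith
  qed (use PQ in simp)
  then show ?thesis
    by (simp only: inner bosonic_sum_swap[of "P + Q" Q])
qed


subsection \<open>Fermionic sums\<close>

lemma power_int_sum:
  "x \<noteq> 0 \<Longrightarrow> x powi (\<Sum>i\<in>A. f i) = (\<Prod>i\<in>A. x powi f i)" for x :: "'a :: field"
  by (induction A rule: infinite_finite_induct) (auto simp: power_int_add)

definition box :: "int \<Rightarrow> nat set \<Rightarrow> (nat \<Rightarrow> int) set" where
  "box K A = {z. \<forall>j. (j \<in> A \<longrightarrow> z j \<in> {0..K}) \<and> (j \<notin> A \<longrightarrow> z j = 0)}"

lemma finite_box: "finite A \<Longrightarrow> finite (box K A)"
  unfolding box_def by (rule finite_set_of_finite_funs) auto

lemma box_empty: "box K {} = {\<lambda>_. 0}"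
  by (auto simp: box_def)

lemma sum_box_insert:
  assumes "a \<notin> A"
  shows "(\<Sum>z\<in>box K (insert a A). f z) = (\<Sum>c\<in>{0..K}. \<Sum>z\<in>box K A. f (z(a := c)))"
proof -
  have "(\<Sum>z\<in>box K (insert a A). f z) = (\<Sum>(c, z)\<in>{0..K} \<times> box K A. f (z(a := c)))"
  proof (rule sum.reindex_bij_witness[of _ "\<lambda>(c, z). z(a := c)" "\<lambda>z. (z a, z(a := 0))"])
    show "(z a, z(a := 0)) \<in> {0..K} \<times> box K A" if "z \<in> box K (insert a A)" for z
      using that by (auto simp: box_def split: if_splits)
    show "(case (z a, z(a := 0)) of (c, z) \<Rightarrow> z(a := c)) = z" for z
      by simp
    show "(case y of (c, z) \<Rightarrow> z(a := c)) \<in> box K (insert a A)" if "y \<in> {0..K} \<times> box K A" for y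
      using that by (auto simp: box_def)
    show "((case y of (c, z) \<Rightarrow> z(a := c)) a, (case y of (c, z) \<Rightarrow> z(a := c))(a := 0)) = y"
      if "y \<in> {0..K} \<times> box K A" for y
      using that assms by (auto simp: box_def fun_eq_iff)
  qed auto
  then show ?thesis by (simp only: sum.cartesian_product)
qed

lemma tpos_Suc: "tpos \<nu> (Suc m) = tpos \<nu> m + \<nu> m"
  by (simp add: tpos_def)

lemma tpos_mono: "a \<le> b \<Longrightarrow> tpos \<nu> a \<le> tpos \<nu> b"
  unfolding tpos_def by (rule sum_mono2) auto

section \<open>Matrix rows as steps of the nested sum\<close>

context fermionic_shape
begin

abbreviation d :: nat where "d \<equiv> dim' n \<nu>"

definition swap_at :: "nat \<Rightarrow> bool" where
  "swap_at t \<longleftrightarrow> (\<exists>m\<in>{1..n - of_bool (\<nu> n = 0)}. t = tpos \<nu> m)"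

definition steps :: "nat \<Rightarrow> bool list" where
  "steps t = map swap_at [t..<d] @ [\<nu> n = 0, False]"

lemma steps_last: "steps d = [\<nu> n = 0, False]"
  by (simp add: steps_def)

lemma steps_Cons: "t < d \<Longrightarrow> steps t = swap_at t # steps (Suc t)"
  by (simp add: steps_def upt_conv_Cons)

text \<open>Row \<open>t\<close> of \<open>I'\<close> applied to \<open>z\<close>, for t \<ge> 2
  (\<open>I'_row_sum\<close>); in halved coordinates it is the upper entry of a q-binomial.\<close>

definition upper :: "nat \<Rightarrow> (nat \<Rightarrow> int) \<Rightarrow> int" where
  "upper t z = z (t - 1) + (if t = d then of_bool (\<nu> n = 0) * z t
     else if swap_at t then z t - z (t + 1) else z (t + 1))"

text \<open>The exponent of q in one step of \<open>fermionic_chain\<close> with L = z t and k = z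
  (t + 1); at t = d it is that of \<open>fermionic_chain_terminal\<close>.\<close>

definition edge :: "nat \<Rightarrow> (nat \<Rightarrow> int) \<Rightarrow> int" where
  "edge t z = (if t = d then (if \<nu> n = 0 then 0 else z t * z t)
     else if swap_at t then z (t + 1) * z (t + 1) else (z t - z (t + 1)) * (z t - z (t + 1)))"

definition weight :: "nat \<Rightarrow> (nat \<Rightarrow> int) \<Rightarrow> rat fls" where
  "weight t z = q powi (edge t z) * qbinom (upper t z) (2 * z t)"

lemma weight_cong:
  assumes "\<And>i. t - 1 \<le> i \<Longrightarrow> z i = z' i"
  shows "weight t z = weight t z'"
proof -
  have "z (t - 1) = z' (t - 1)" "z t = z' t" "z (t + 1) = z' (t + 1)"
    by (rule assms, simp)+
  then show ?thesis by (simp only: weight_def edge_def upper_def)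
qed

text \<open>Completing squares from the last row upwards. At a swap row the cross terms in z s and z
  (s + 1) cancel; at other rows they double and complete the square of z s - z (s + 1).\<close>

lemma sum_edge:
  assumes "s \<le> d" "0 < s"
  shows "(\<Sum>t=s..d. z t * (2 * z t - upper t z)) = z s * z s - z (s - 1) * z s + (\<Sum>t=s..d. edge t z)"
  using assms
proof (induction s rule: inc_induct)
  case base
  then show ?case by (auto simp: upper_def edge_def algebra_simps)
next
  case (step s)
  have 1: "z s * (2 * z s - upper s z) + (z (Suc s) * z (Suc s) - z s * z (Suc s))
      = z s * z s - z (s - 1) * z s + edge s z"
    using step.hyps by (auto simp: upper_def edge_def algebra_simps)
  have "(\<Sum>t=s..d. z t * (2 * z t - upper t z)) = z s * (2 * z s - upper s z) + (\<Sum>t=Suc s..d. z t * (2 * z t - upper t z))"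
    "(\<Sum>t=s..d. edge t z) = edge s z + (\<Sum>t=Suc s..d. edge t z)"
    using step.hyps by (auto intro!: sum.atLeast_Suc_atMost)
  then show ?case using step.IH 1 by simp
qed

text \<open>Row \<open>s\<close> with \<open>z (s - 1) = u\<close> and \<open>z s = v\<close> is a
  chain step with L = v and M = u - v, so that 2 L + M = u + v and L + M = u. Splitting off
  coordinate s + 1 peels one flag, since later rows do not see \<open>z (s - 1)\<close>.\<close>

lemma sum_box_weight:
  assumes "s \<le> d" "0 < s" "0 \<le> v" "v \<le> K"
  shows "(\<Sum>z\<in>box K {Suc s..d}. \<Prod>t=s..d. weight t (z(s := v, s - 1 := u))) = fermionic_chain (steps s) v (u - v)"
  using assms
proof (induction s arbitrary: u v rule: inc_induct)
  case base
  have "weight d ((\<lambda>_. 0)(d := v, d - 1 := u)) = fermionic_chain (steps d) v (u - v)"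
    unfolding steps_last fermionic_chain_terminal[OF \<open>0 \<le> v\<close>]
    using base by (auto simp: weight_def edge_def upper_def add.commute)
  then show ?case by (simp add: box_empty fun_upd_def)
next
  case (step s)
  let ?w = "\<lambda>c. if swap_at s then q powi (c * c) * qbinom (u + v - c) (2 * v)
    else q powi ((v - c) * (v - c)) * qbinom (u + c) (2 * v)"
  have "{Suc s..d} = insert (Suc s) {Suc (Suc s)..d}"
    using step.hyps by auto
  then have "(\<Sum>z\<in>box K {Suc s..d}. \<Prod>t=s..d. weight t (z(s := v, s - 1 := u)))
      = (\<Sum>c\<in>{0..K}. \<Sum>z\<in>box K {Suc (Suc s)..d}. \<Prod>t=s..d. weight t (z(Suc s := c, s := v, s - 1 := u)))"
    by (simp only:) (rule sum_box_insert, simp)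
  also have "\<dots> = (\<Sum>c\<in>{0..K}. ?w c * (\<Sum>z\<in>box K {Suc (Suc s)..d}. \<Prod>t=Suc s..d. weight t (z(Suc s := c, Suc s - 1 := v))))"
    unfolding sum_distrib_left
  proof (intro sum.cong refl)
    fix c z
    have "(\<Prod>t=s..d. weight t (z(Suc s := c, s := v, s - 1 := u)))
        = weight s (z(Suc s := c, s := v, s - 1 := u)) * (\<Prod>t=Suc s..d. weight t (z(Suc s := c, s := v, s - 1 := u)))"
      using step.hyps by (intro prod.atLeast_Suc_atMost) simp
    also have "weight s (z(Suc s := c, s := v, s - 1 := u)) = ?w c"
      using step.hyps step.prems by (auto simp: weight_def edge_def upper_def add_diff_eq)
    also have "(\<Prod>t=Suc s..d. weight t (z(Suc s := c, s := v, s - 1 := u))) = (\<Prod>t=Suc s..d. weight t (z(Suc s := c, Suc s - 1 := v)))"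
      using step.prems by (intro prod.cong refl weight_cong) auto
    finally show "(\<Prod>t=s..d. weight t (z(Suc s := c, s := v, s - 1 := u)))
        = ?w c * (\<Prod>t=Suc s..d. weight t (z(Suc s := c, Suc s - 1 := v)))" .
  qed
  also have "\<dots> = (\<Sum>c\<in>{0..K}. ?w c * fermionic_chain (steps (Suc s)) c (v - c))"
  proof (rule sum.cong[OF refl])
    fix c assume "c \<in> {0..K}"
    then have "0 \<le> c" "c \<le> K" by auto
    from step.IH[OF zero_less_Suc this, of v] show "?w c * (\<Sum>z\<in>box K {Suc (Suc s)..d}. \<Prod>t=Suc s..d. weight t (z(Suc s := c, Suc s - 1 := v)))
      = ?w c * fermionic_chain (steps (Suc s)) c (v - c)" by (simp only:)
  qed
  \<comment> \<open>For c > v the chain has negative second argument and vanishes.\<close>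
  also have "\<dots> = (\<Sum>c\<in>{0..v}. ?w c * fermionic_chain (steps (Suc s)) c (v - c))"
    using step.prems by (intro sum.mono_neutral_right) (auto simp: fermionic_chain_neg)
  also have "\<dots> = fermionic_chain (steps s) v (u - v)"
  proof -
    have "2 * v + (u - v) - k = u + v - k" "v + (u - v) + k = u + k" for k by simp_all
    then show ?thesis using step.hyps by (simp only: steps_Cons fermionic_chain.simps)
  qed
  finally show ?case .
qed

section \<open>The flags and the continued fraction\<close>

text \<open>Rows t_m + 1, ..., t_(m+1) account for the partial quotient \<nu> m: each adds 1, and
  for m < n the flag at t_(m+1) inverts the remaining ratio. The trailing \<open>[False]\<close>, of
  ratio 2, supplies the closing + 2.\<close>

lemma chain_ratio_steps_1:
  "chain_ratio (steps 1) = cf_value (map \<nu> [0..<n] @ [\<nu> n + 2])" if pos: "\<forall>i<n. 1 \<le> \<nu> i"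
proof -
  \<comment> \<open>Index of the last nonempty block. If \<nu> n = 0 then d = t_n, and the flag
    \<open>\<nu> n = 0\<close> in \<open>steps\<close> takes the place of the swap at t_n.\<close>
  define N where "N = n - of_bool (\<nu> n = 0)"
  define C where "C m = cf_value (map \<nu> [m..<n] @ [\<nu> n + 2])" for m
  have n: "0 < n" if "\<nu> n = 0"
    using dim'_ge that by (cases n) (auto simp: dim'_def)
  have dN: "d = tpos \<nu> (Suc N)"
    using n by (cases "\<nu> n = 0") (auto simp: N_def dim'_def tpos_def lessThan_Suc_atMost[symmetric])
  have pos': "1 \<le> \<nu> m" if "m \<le> N" for m
  proof (cases "m < n")
    case False
    with that n have "m = n" "\<nu> n \<noteq> 0" by (cases "\<nu> n = 0"; auto simp: N_def)+
    then show ?thesis by simp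
  qed (use pos in auto)
  have C_n: "C n = of_nat (\<nu> n) + 2" by (simp add: C_def)
  have C_step: "C m = of_nat (\<nu> m) + 1 / C (Suc m)" if "m < n" for m
  proof -
    obtain z zs where z: "map \<nu> [Suc m..<n] @ [\<nu> n + 2] = z # zs"
      by (cases "map \<nu> [Suc m..<n]") auto
    then show ?thesis using that by (simp add: C_def upt_conv_Cons)
  qed
  have within: "chain_ratio (steps (tpos \<nu> (Suc m) - k)) = chain_ratio (steps (tpos \<nu> (Suc m))) + of_nat k"
    if m: "m \<le> N" and "k < \<nu> m" for m k
    using that(2)
  proof (induction k)
    case (Suc k)
    define t where "t = tpos \<nu> (Suc m) - Suc k"
    have t: "tpos \<nu> m < t" "t < tpos \<nu> (Suc m)" "Suc t = tpos \<nu> (Suc m) - k"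
      using Suc.prems by (auto simp: t_def tpos_Suc)
    have "t < d" using t(2) tpos_mono[of "Suc m" "Suc N" \<nu>] m by (simp add: dN)
    moreover have "\<not> swap_at t"
    proof
      assume "swap_at t"
      then obtain i where "t = tpos \<nu> i" by (auto simp: swap_at_def)
      moreover have "tpos \<nu> i \<le> tpos \<nu> m \<or> tpos \<nu> (Suc m) \<le> tpos \<nu> i"
        using tpos_mono[of i m \<nu>] tpos_mono[of "Suc m" i \<nu>] by linarith
      ultimately show False using t by linarith
    qed
    ultimately have "chain_ratio (steps t) = 1 + chain_ratio (steps (tpos \<nu> (Suc m) - k))"
      using t(3) by (simp add: steps_Cons)
    with Suc show ?case by (simp add: t_def)
  qed simp
  have first: "chain_ratio (steps (Suc (tpos \<nu> m))) = chain_ratio (steps (tpos \<nu> (Suc m))) + (of_nat (\<nu> m) - 1)"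
    if "m \<le> N" for m
  proof -
    have "tpos \<nu> (Suc m) - (\<nu> m - 1) = Suc (tpos \<nu> m)"
      using pos'[OF that] by (simp add: tpos_Suc)
    then show ?thesis
      using within[OF that, of "\<nu> m - 1"] pos'[OF that] by (simp add: of_nat_diff)
  qed
  have "chain_ratio (steps (Suc (tpos \<nu> m))) = C m" if "m \<le> N" for m
    using that
  proof (induction m rule: inc_induct)
    case base
    \<comment> \<open>3/2 and 3 are the ratios of \<open>[True, False]\<close> and
      \<open>[False, False]\<close>.\<close>
    have "chain_ratio (steps (Suc (tpos \<nu> N))) = (if \<nu> n = 0 then 3 / 2 else 3) + (of_nat (\<nu> N) - 1)"
      unfolding first[OF order_refl] dN[symmetric] steps_last by simp
    also have "\<dots> = C N"
    proof (cases "\<nu> n = 0")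
      case True
      then have "N < n" "Suc N = n" using n by (auto simp: N_def)
      then show ?thesis using C_step[of N] C_n True by simp
    next
      case False
      then have "N = n" by (simp add: N_def)
      then show ?thesis using C_n False by simp
    qed
    finally show ?case .
  next
    case (step m)
    have "tpos \<nu> (Suc m) < tpos \<nu> (Suc (Suc m))"
      using pos'[of "Suc m"] step.hyps by (simp add: tpos_Suc[of _ "Suc m"])
    also have "\<dots> \<le> d" unfolding dN by (rule tpos_mono) (use step.hyps in simp)
    finally have "tpos \<nu> (Suc m) < d" .
    moreover have "swap_at (tpos \<nu> (Suc m))"
      unfolding swap_at_def N_def[symmetric] using step.hyps by (intro bexI[of _ "Suc m"]) auto
    ultimately have "chain_ratio (steps (tpos \<nu> (Suc m))) = 1 + 1 / chain_ratio (steps (Suc (tpos \<nu> (Suc m))))"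
      by (simp add: steps_Cons)
    moreover have "m < n" using step.hyps by (simp add: N_def)
    ultimately show ?case using first[of m] step C_step[of m] by simp
  qed
  from this[of 0] show ?thesis by (simp add: tpos_def C_def)
qed

section \<open>Halving the summation vectors\<close>

text \<open>Halved coordinates: \<open>z 1 = (m 1 + m 2) / 2\<close>, \<open>z t = m (t + 1) / 2\<close> for \<open>t \<ge> 2\<close>, and \<open>x = m 2\<close>.\<close>

definition embed :: "int \<times> (nat \<Rightarrow> int) \<Rightarrow> nat \<Rightarrow> int" where
  "embed = (\<lambda>(x, z) j. if j = 1 then 2 * z 1 - x else if j = 2 then x else 2 * z (j - 1))"

lemma bij_betw_embed:
  "bij_betw embed (UNIV \<times> {z. \<forall>j. j \<notin> {1..d} \<longrightarrow> z j = 0}) (summation_vectors n \<nu>)"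
\<comment> \<open>The factor \<open>of_bool (j \<noteq> 0)\<close> keeps index 0 at 0, where
  otherwise \<open>m 1 div 2\<close> would appear.\<close>
proof (rule bij_betw_byWitness[where f' = "\<lambda>m. (m 2, \<lambda>j. if j = 1 then (m 1 + m 2) div 2 else m (j + 1) div 2 * of_bool (j \<noteq> 0))"])
  show "\<forall>y\<in>UNIV \<times> {z. \<forall>j. j \<notin> {1..d} \<longrightarrow> z j = 0}.
      (embed y 2, \<lambda>j. if j = 1 then (embed y 1 + embed y 2) div 2 else embed y (j + 1) div 2 * of_bool (j \<noteq> 0)) = y"
    by (auto simp: embed_def fun_eq_iff)
  show "\<forall>m\<in>summation_vectors n \<nu>.
      embed (m 2, \<lambda>j. if j = 1 then (m 1 + m 2) div 2 else m (j + 1) div 2 * of_bool (j \<noteq> 0)) = m"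
  proof
    fix m assume m: "m \<in> summation_vectors n \<nu>"
    show "embed (m 2, \<lambda>j. if j = 1 then (m 1 + m 2) div 2 else m (j + 1) div 2 * of_bool (j \<noteq> 0)) = m"
    proof
      fix j :: nat
      consider "j = 0" | "j = 1" | "j = 2" | "3 \<le> j" by linarith
      then show "embed (m 2, \<lambda>j. if j = 1 then (m 1 + m 2) div 2 else m (j + 1) div 2 * of_bool (j \<noteq> 0)) j = m j"
      proof cases
        case 1
        then show ?thesis using m by (simp add: embed_def summation_vectors_def)
      next
        case 2
        then show ?thesis using summation_vectors_even(1)[OF m] by (simp add: embed_def)
      next
        case 4
        then show ?thesis using summation_vectors_even(2)[OF m, of j] by (auto simp: embed_def)
      qed (simp add: embed_def)
    qed
  qed
  show "embed ` (UNIV \<times> {z. \<forall>j. j \<notin> {1..d} \<longrightarrow> z j = 0}) \<subseteq> summation_vectors n \<nu>"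
  proof (rule image_subsetI)
    fix y assume "y \<in> (UNIV :: int set) \<times> {z :: nat \<Rightarrow> int. \<forall>j. j \<notin> {1..d} \<longrightarrow> z j = 0}"
    then obtain x z where y: "y = (x, z)" "\<And>j. j \<notin> {1..d} \<Longrightarrow> z j = 0" by auto
    have "embed (x, z) j = 0" if "j \<notin> {1..Suc d}" for j
    proof (cases "j = 0")
      case True
      then show ?thesis using y(2)[of 0] by (simp add: embed_def)
    next
      case False
      then have "j - 1 \<notin> {1..d}" "3 < j" using that dim'_ge by auto
      from y(2)[OF this(1)] this(2) show ?thesis by (simp add: embed_def)
    qed
    then show "embed y \<in> summation_vectors n \<nu>"
      unfolding y(1) by (auto simp: summation_vectors_def dim''_def) (auto simp: embed_def)
  qed
  show "(\<lambda>m. (m 2, \<lambda>j. if j = 1 then (m 1 + m 2) div 2 else m (j + 1) div 2 * of_bool (j \<noteq> 0))) ` summation_vectors n \<nu>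
      \<subseteq> UNIV \<times> {z. \<forall>j. j \<notin> {1..d} \<longrightarrow> z j = 0}"
    using dim'_ge by (auto simp: summation_vectors_def dim''_def)
qed

lemma I'_row_sum:
  assumes "2 \<le> t" "t \<le> d"
  shows "(\<Sum>l=1..d. I' n \<nu> t l * f l) = upper t f"
proof -
  have 1: "(\<Sum>l=1..d. of_bool (t = l + 1) * f l) = f (t - 1)"
  proof -
    have "(\<Sum>l=1..d. of_bool (t = l + 1) * f l) = (\<Sum>l=1..d. if l = t - 1 then f l else 0)"
      using assms by (intro sum.cong) auto
    then show ?thesis using assms by auto
  qed
  have 2: "(\<Sum>l=1..d. of_bool (t = l) * f l) = f t"
  proof -
    have "(\<Sum>l=1..d. of_bool (t = l) * f l) = (\<Sum>l=1..d. if l = t then f l else 0)"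
      by (intro sum.cong) auto
    then show ?thesis using assms by auto
  qed
  have 3: "(\<Sum>l=1..d. of_bool (t + 1 = l) * f l) = f (t + 1)" if "t \<noteq> d"
  proof -
    have "(\<Sum>l=1..d. of_bool (t + 1 = l) * f l) = (\<Sum>l=1..d. if l = t + 1 then f l else 0)"
      by (intro sum.cong) auto
    then show ?thesis using assms that by auto
  qed
  consider "t = d" | "t \<noteq> d" "swap_at t" | "t \<noteq> d" "\<not> swap_at t" by blast
  then show ?thesis
  proof cases
    case 1
    then show ?thesis
      using \<open>(\<Sum>l=1..d. of_bool (t = l + 1) * f l) = f (t - 1)\<close> 2
      by (simp only: I'_def upper_def simp_thms if_True ring_distribs sum.distrib mult.assoc sum_distrib_left[symmetric])
  next
    case 2
    then show ?thesis
      using 1 \<open>(\<Sum>l=1..d. of_bool (t = l) * f l) = f t\<close> 3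
      by (simp only: I'_def upper_def swap_at_def[symmetric] simp_thms if_True if_False ring_distribs sum.distrib sum_subtractf left_diff_distrib)
  next
    case 3
    then show ?thesis
      using 1 \<open>t \<noteq> d \<Longrightarrow> (\<Sum>l=1..d. of_bool (t + 1 = l) * f l) = f (t + 1)\<close>
      by (simp only: I'_def upper_def swap_at_def[symmetric] simp_thms if_True if_False ring_distribs sum.distrib)
  qed
qed

text \<open>The first column meets these rows only at t = 2, where m_1 joins m_2 to give 2 z_1, the
  left neighbour that \<open>upper\<close> expects.\<close>

lemma I''_app_embed:
  assumes "2 \<le> t" "t \<le> d"
  shows "I''_app n \<nu> (embed (x, z)) (Suc t) = 2 * upper t z"
proof -
  let ?m = "embed (x, z)"
  have "I''_app n \<nu> ?m (Suc t) = I'' n \<nu> (Suc t) 1 * ?m 1 + (\<Sum>k=Suc 1..Suc d. I'' n \<nu> (Suc t) k * ?m k)"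
    unfolding I''_app_def dim''_def by (subst sum.atLeast_Suc_atMost) auto
  also have "(\<Sum>k=Suc 1..Suc d. I'' n \<nu> (Suc t) k * ?m k) = (\<Sum>l=1..d. I' n \<nu> t l * ?m (Suc l))"
    unfolding sum.shift_bounds_cl_Suc_ivl using assms by (intro sum.cong) (auto simp: I''_def)
  also have "\<dots> = upper t (\<lambda>l. ?m (Suc l))"
    by (rule I'_row_sum[OF assms])
  also have "I'' n \<nu> (Suc t) 1 * ?m 1 + \<dots> = 2 * upper t z"
  proof (cases "t = 2")
    case True
    then show ?thesis by (auto simp: I''_def embed_def upper_def numeral_2_eq_2)
  next
    case False
    then show ?thesis using assms by (auto simp: I''_def embed_def upper_def)
  qed
  finally show ?thesis .
qed

lemma B''_form_eq: "B''_form n \<nu> m / 2 = of_int (\<Sum>j=1..dim'' n \<nu>. m j * (2 * m j - I''_app n \<nu> m j)) / 4"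
proof -
  let ?d = "dim'' n \<nu>"
  let ?f = "\<lambda>j. m j * (2 * m j - I''_app n \<nu> m j)"
  have row: "(\<Sum>k=1..?d. of_int (m j) * B'' n \<nu> j k * of_int (m k)) = of_int (?f j) / 2"
    if "j \<in> {1..?d}" for j
  proof -
    have "(\<Sum>k=1..?d. of_int (m j) * B'' n \<nu> j k * of_int (m k))
        = (\<Sum>k=1..?d. of_int (m j) * (if k = j then of_int (m k) else 0))
          - (\<Sum>k=1..?d. of_int (m j) / 2 * of_int (I'' n \<nu> j k * m k))"
      unfolding sum_subtractf[symmetric]
      by (intro sum.cong) (auto simp: B''_def field_simps)
    also have "\<dots> = of_int (?f j) / 2"
      unfolding sum_distrib_left[symmetric] I''_app_def using that
      by (simp add: field_simps)
    finally show ?thesis .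
  qed
  have "B''_form n \<nu> m = (\<Sum>j=1..?d. of_int (?f j) / 2)"
    unfolding B''_form_def by (intro sum.cong row) auto
  also have "\<dots> = of_int (\<Sum>j=1..?d. ?f j) / 2"
    unfolding of_int_sum sum_divide_distrib ..
  finally show ?thesis by simp
qed

lemma atLeast1AtMost_dim'': "{1..dim'' n \<nu>} = {1, 2} \<union> Suc ` {2..d}"
  using dim'_ge by (auto simp: dim''_def image_iff)

text \<open>The rows from 2 on give the weights. Together with the boundary term of
  \<open>sum_edge\<close>, the terms in m_1 and m_2 form z_1^2 + (z_1 - z_2)^2 + (z_2 - x)(2 z_1 -
  x), whose last summand is the q-Vandermonde exponent for the sum over \<open>x\<close>.\<close>

lemma summand_embed:
  "q powi \<lfloor>B''_form n \<nu> (embed (x, z)) / 2\<rfloor> *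
      (\<Prod>j=1..dim'' n \<nu>.
        qbinom \<lfloor>of_int (L * of_bool (j = 1)) + of_int (I''_app n \<nu> (embed (x, z)) j) / (2 :: rat)\<rfloor> (embed (x, z) j))
   = q powi (z 1 * z 1) * q powi ((z 1 - z 2) * (z 1 - z 2)) * (\<Prod>t=2..d. weight t z) *
      (q powi ((z 2 - x) * (2 * z 1 - x)) * qbinom (z 2) x * qbinom (L - z 2) (2 * z 1 - x))"
proof -
  let ?m = "embed (x, z)"
  have m: "?m 1 = 2 * z 1 - x" "?m 2 = x" "?m 3 = 2 * z 2" "\<And>t. t \<in> {2..d} \<Longrightarrow> ?m (Suc t) = 2 * z t"
    by (auto simp: embed_def)
  have app: "I''_app n \<nu> ?m 1 = - 2 * z 2" "I''_app n \<nu> ?m 2 = 2 * z 2"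
    "\<And>t. t \<in> {2..d} \<Longrightarrow> I''_app n \<nu> ?m (Suc t) = 2 * upper t z"
    using I''_app_1[of ?m] I''_app_2[of ?m] m(3) I''_app_embed by auto
  have fl4: "\<lfloor>of_int (4 * w) / (4 :: rat)\<rfloor> = w" for w by simp
  have "(\<Sum>j=1..dim'' n \<nu>. ?m j * (2 * ?m j - I''_app n \<nu> ?m j))
      = (\<Sum>j\<in>{1, 2}. ?m j * (2 * ?m j - I''_app n \<nu> ?m j)) + (\<Sum>j\<in>Suc ` {2..d}. ?m j * (2 * ?m j - I''_app n \<nu> ?m j))"
    unfolding atLeast1AtMost_dim'' by (rule sum.union_disjoint) auto
  also have "(\<Sum>j\<in>Suc ` {2..d}. ?m j * (2 * ?m j - I''_app n \<nu> ?m j)) = 4 * (\<Sum>t=2..d. z t * (2 * z t - upper t z))"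
    unfolding sum_distrib_left by (subst sum.reindex) (auto simp: m app algebra_simps intro!: sum.cong)
  also have "(\<Sum>t=2..d. z t * (2 * z t - upper t z)) = z 2 * z 2 - z 1 * z 2 + (\<Sum>t=2..d. edge t z)"
    using sum_edge[of 2 z] dim'_ge by simp
  also have "(\<Sum>j\<in>{1, 2}. ?m j * (2 * ?m j - I''_app n \<nu> ?m j)) + 4 * (z 2 * z 2 - z 1 * z 2 + (\<Sum>t=2..d. edge t z))
    = 4 * (z 1 * z 1 + (z 1 - z 2) * (z 1 - z 2) + (\<Sum>t=2..d. edge t z) + (z 2 - x) * (2 * z 1 - x))"
    by (simp add: m app del: One_nat_def) (simp add: algebra_simps)
  finally have floor: "\<lfloor>B''_form n \<nu> ?m / 2\<rfloor> = z 1 * z 1 + (z 1 - z 2) * (z 1 - z 2) + (\<Sum>t=2..d. edge t z) + (z 2 - x) * (2 * z 1 - x)"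
    unfolding B''_form_eq by (simp only: fl4)
  let ?g = "\<lambda>j. qbinom \<lfloor>of_int (L * of_bool (j = 1)) + of_int (I''_app n \<nu> ?m j) / (2 :: rat)\<rfloor> (?m j)"
  have fl: "\<lfloor>of_int a + of_int (2 * b) / (2 :: rat)\<rfloor> = a + b" for a b by simp
  have "(\<Prod>j=1..dim'' n \<nu>. ?g j) = (\<Prod>j\<in>{1, 2}. ?g j) * (\<Prod>j\<in>Suc ` {2..d}. ?g j)"
    unfolding atLeast1AtMost_dim'' by (rule prod.union_disjoint) auto
  also have "(\<Prod>j\<in>Suc ` {2..d}. ?g j) = (\<Prod>t=2..d. qbinom (upper t z) (2 * z t))"
    by (subst prod.reindex) (auto simp: m app intro!: prod.cong)
  also have "(\<Prod>j\<in>{1, 2}. ?g j) = qbinom (L - z 2) (2 * z 1 - x) * qbinom (z 2) x"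
    using fl[of L "- z 2"] m app by (simp del: One_nat_def)
  finally have prod: "(\<Prod>j=1..dim'' n \<nu>. ?g j)
      = qbinom (L - z 2) (2 * z 1 - x) * qbinom (z 2) x * (\<Prod>t=2..d. qbinom (upper t z) (2 * z t))" .
  show ?thesis
    unfolding floor prod weight_def prod.distrib qpow_mult[symmetric] power_int_sum[OF fls_X_nonzero] by (simp only: mult_ac)
qed

text \<open>Finite support allows one cut-off \<open>K\<close> for all variables. The sum over
  \<open>x\<close> is then evaluated by q-Vandermonde and the sum over the coordinates beyond 2 by
  \<open>sum_box_weight\<close>.\<close>

lemma fermionic_sum_eq:
  "\<exists>K\<ge>L. sum' (\<lambda>m. q powi \<lfloor>B''_form n \<nu> m / 2\<rfloor> *
        (\<Prod>j=1..dim'' n \<nu>.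
          qbinom \<lfloor>of_int (L * of_bool (j = 1)) + of_int (I''_app n \<nu> m j) / (2 :: rat)\<rfloor> (m j)))
       (summation_vectors n \<nu>)
    = (\<Sum>N\<in>{0..K}. q powi (N * N) * qbinom L (2 * N) *
      (\<Sum>k\<in>{0..N}. q powi ((N - k) * (N - k)) * fermionic_chain (steps 2) k (N - k)))"
proof -
  let ?F = "\<lambda>m. q powi \<lfloor>B''_form n \<nu> m / 2\<rfloor> *
        (\<Prod>j=1..dim'' n \<nu>.
          qbinom \<lfloor>of_int (L * of_bool (j = 1)) + of_int (I''_app n \<nu> m j) / (2 :: rat)\<rfloor> (m j))"
  let ?Z = "{z :: nat \<Rightarrow> int. \<forall>j. j \<notin> {1..d} \<longrightarrow> z j = 0}"
  define W where "W x z = q powi (z 1 * z 1) * q powi ((z 1 - z 2) * (z 1 - z 2)) * (\<Prod>t=2..d. weight t z) *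
      (q powi ((z 2 - x) * (2 * z 1 - x)) * qbinom (z 2) x * qbinom (L - z 2) (2 * z 1 - x))" for x z
  have FW: "?F (embed p) = (case p of (x, z) \<Rightarrow> W x z)" for p
    by (cases p) (simp only: summand_embed W_def prod.case)
  define S where "S = {p \<in> UNIV \<times> ?Z. ?F (embed p) \<noteq> 0}"
  have "bij_betw embed S {m \<in> summation_vectors n \<nu>. ?F m \<noteq> 0}"
    unfolding S_def by (rule bij_betw_Collect_preimage[OF bij_betw_embed])
  then have fin: "finite S"
    by (rule iffD2[OF bij_betw_finite]) (rule fermionic_finite_support)
  \<comment> \<open>All coordinates of all nonzero terms, together with \<open>L\<close>; their
    maximum is the cut-off.\<close>
  define R where "R = {L} \<union> (\<Union>(x, z)\<in>S. insert x (z ` {1..d}))"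
  define K where "K = Max R"
  have finR: "finite R" using fin by (auto simp: R_def)
  have K: "y \<le> K" if "y \<in> R" for y using finR that by (simp add: K_def)
  have LK: "L \<le> K" by (rule K) (simp add: R_def)
  have S_box: "p \<in> {0..K} \<times> box K {1..d}" if p: "p \<in> S" for p
  proof -
    obtain x z where xz: "p = (x, z)" "z \<in> ?Z" using p by (auto simp: S_def)
    have "W x z \<noteq> 0" using p unfolding S_def FW xz by simp
    then have nz: "qbinom (z 2) x \<noteq> 0" "qbinom (L - z 2) (2 * z 1 - x) \<noteq> 0" "\<And>t. t \<in> {2..d} \<Longrightarrow> weight t z \<noteq> 0"
      by (auto simp: W_def)
    have x: "0 \<le> x" and z1: "0 \<le> z 1"
      using qbinom_nonzeroD[OF nz(1)] qbinom_nonzeroD[OF nz(2)] by auto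
    have z2: "0 \<le> z t" if "t \<in> {2..d}" for t
      using nz(3)[OF that] qbinom_nonzeroD[of "upper t z" "2 * z t"] by (auto simp: weight_def)
    have "0 \<le> z t" if "t \<in> {1..d}" for t
      using z1 z2[of t] that by (cases "t = 1") auto
    moreover have "x \<le> K" by (rule K) (use p xz in \<open>force simp: R_def\<close>)
    moreover have "z t \<le> K" if "t \<in> {1..d}" for t
      by (rule K) (use p xz that in \<open>force simp: R_def\<close>)
    ultimately show ?thesis using x xz by (auto simp: box_def)
  qed
  have "sum' ?F (summation_vectors n \<nu>) = sum' (\<lambda>p. ?F (embed p)) (UNIV \<times> ?Z)"
    by (rule sum'_reindex_bij_betw[OF bij_betw_embed, symmetric])
  also have "\<dots> = (\<Sum>p\<in>{0..K} \<times> box K {1..d}. ?F (embed p))"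
  proof (rule sum'_eq_sum)
    show "p \<in> {0..K} \<times> box K {1..d}" if "p \<in> UNIV \<times> ?Z" "?F (embed p) \<noteq> 0" for p
      using that by (intro S_box) (simp only: S_def mem_Collect_eq simp_thms)
    show "finite ({0..K} \<times> box K {1..d})"
      by (intro finite_cartesian_product finite_box finite_atLeastAtMost_int finite_atLeastAtMost)
    show "{0..K} \<times> box K {1..d} \<subseteq> UNIV \<times> ?Z"
      by (auto simp: box_def)
  qed
  also have "\<dots> = (\<Sum>x\<in>{0..K}. \<Sum>z\<in>box K {1..d}. W x z)"
    unfolding FW by (simp only: sum.cartesian_product)
  also have "\<dots> = (\<Sum>z\<in>box K {1..d}. \<Sum>x\<in>{0..K}. W x z)"
    by (rule sum.swap)
  also have "{1..d} = insert 1 (insert 2 {Suc 2..d})"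
    using dim'_ge by auto
  also have "(\<Sum>z\<in>box K \<dots>. \<Sum>x\<in>{0..K}. W x z)
      = (\<Sum>N\<in>{0..K}. \<Sum>k\<in>{0..K}. \<Sum>z\<in>box K {Suc 2..d}. \<Sum>x\<in>{0..K}. W x (z(2 := k, 1 := N)))"
  proof -
    have "(\<Sum>z\<in>box K (insert 1 (insert 2 {Suc 2..d})). f z)
        = (\<Sum>N\<in>{0..K}. \<Sum>k\<in>{0..K}. \<Sum>z\<in>box K {Suc 2..d}. f (z(2 := k, 1 := N)))"
      for f :: "(nat \<Rightarrow> int) \<Rightarrow> rat fls"
      by (subst sum_box_insert, simp, subst sum_box_insert) simp_all
    then show ?thesis .
  qed
  also have "\<dots> = (\<Sum>N\<in>{0..K}. \<Sum>k\<in>{0..K}. q powi (N * N) * qbinom L (2 * N) * (q powi ((N - k) * (N - k)) * fermionic_chain (steps 2) k (N - k)))"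
  proof (intro sum.cong refl)
    fix N k assume N: "N \<in> {0..K}" and k: "k \<in> {0..K}"
    \<comment> \<open>The sum over x = m_2, with N = (m_1 + m_2) / 2 held fixed.\<close>
    define V where "V = (\<Sum>x\<in>{0..K}. q powi ((k - x) * (2 * N - x)) * qbinom k x * qbinom (L - k) (2 * N - x))"
    have "(\<Sum>z\<in>box K {Suc 2..d}. \<Sum>x\<in>{0..K}. W x (z(2 := k, 1 := N)))
        = (\<Sum>z\<in>box K {Suc 2..d}. q powi (N * N) * q powi ((N - k) * (N - k)) * V * (\<Prod>t=2..d. weight t (z(2 := k, 2 - 1 := N))))"
    proof (rule sum.cong[OF refl])
      fix z
      have "W x (z(2 := k, 1 := N)) = q powi (N * N) * q powi ((N - k) * (N - k)) * (\<Prod>t=2..d. weight t (z(2 := k, 2 - 1 := N)))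
          * (q powi ((k - x) * (2 * N - x)) * qbinom k x * qbinom (L - k) (2 * N - x))" for x
        by (simp add: W_def)
      then have "(\<Sum>x\<in>{0..K}. W x (z(2 := k, 1 := N)))
          = q powi (N * N) * q powi ((N - k) * (N - k)) * (\<Prod>t=2..d. weight t (z(2 := k, 2 - 1 := N))) * V"
        by (simp only: V_def sum_distrib_left)
      then show "(\<Sum>x\<in>{0..K}. W x (z(2 := k, 1 := N)))
          = q powi (N * N) * q powi ((N - k) * (N - k)) * V * (\<Prod>t=2..d. weight t (z(2 := k, 2 - 1 := N)))"
        by (simp only: mult_ac)
    qed
    also have "\<dots> = q powi (N * N) * q powi ((N - k) * (N - k)) * V * fermionic_chain (steps 2) k (N - k)"
      unfolding sum_distrib_left[symmetric] using k dim'_ge by (subst sum_box_weight) auto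
    also have "\<dots> = q powi (N * N) * q powi ((N - k) * (N - k)) * (V * fermionic_chain (steps 2) k (N - k))"
      by (rule mult.assoc)
    also have "V * fermionic_chain (steps 2) k (N - k) = qbinom L (2 * N) * fermionic_chain (steps 2) k (N - k)"
    \<comment> \<open>For k > L the sum \<open>V\<close> is 0, while \<open>qbinom L (2 * N)\<close>
      may not be; but 2 N \<le> L < k forces N < k, where the chain factor vanishes.\<close>
    proof (cases "N < k")
      case True
      then show ?thesis by (simp add: fermionic_chain_neg)
    next
      case False
      have "V = qbinom L (2 * N)"
      proof (cases "k \<le> L")
        case True
        then have "V = qbinom (k + (L - k)) (2 * N)"
          unfolding V_def using k by (intro q_vandermonde) auto
        then show ?thesis by simp
      next
        case kL: False
        have "V = 0" unfolding V_def using kL by (intro sum.neutral) (auto simp: qbinom_def)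
        moreover have "qbinom L (2 * N) = 0" using kL False k by (auto simp: qbinom_def)
        ultimately show ?thesis by simp
      qed
      then show ?thesis by simp
    qed
    also have "q powi (N * N) * q powi ((N - k) * (N - k)) * (qbinom L (2 * N) * fermionic_chain (steps 2) k (N - k))
        = q powi (N * N) * qbinom L (2 * N) * (q powi ((N - k) * (N - k)) * fermionic_chain (steps 2) k (N - k))"
      by (simp only: mult_ac)
    finally show "(\<Sum>z\<in>box K {Suc 2..d}. \<Sum>x\<in>{0..K}. W x (z(2 := k, 1 := N)))
        = q powi (N * N) * qbinom L (2 * N) * (q powi ((N - k) * (N - k)) * fermionic_chain (steps 2) k (N - k))" .
  qed
  also have "\<dots> = (\<Sum>N\<in>{0..K}. q powi (N * N) * qbinom L (2 * N) *
      (\<Sum>k\<in>{0..N}. q powi ((N - k) * (N - k)) * fermionic_chain (steps 2) k (N - k)))"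
  proof (rule sum.cong[OF refl])
    fix N assume "N \<in> {0..K}"
    then have "(\<Sum>k\<in>{0..K}. q powi ((N - k) * (N - k)) * fermionic_chain (steps 2) k (N - k))
        = (\<Sum>k\<in>{0..N}. q powi ((N - k) * (N - k)) * fermionic_chain (steps 2) k (N - k))"
      by (intro sum.mono_neutral_right) (auto simp: fermionic_chain_neg)
    then show "(\<Sum>k\<in>{0..K}. q powi (N * N) * qbinom L (2 * N) * (q powi ((N - k) * (N - k)) * fermionic_chain (steps 2) k (N - k)))
        = q powi (N * N) * qbinom L (2 * N) * (\<Sum>k\<in>{0..N}. q powi ((N - k) * (N - k)) * fermionic_chain (steps 2) k (N - k))"
      by (simp only: sum_distrib_left[symmetric])
  qed
  finally show ?thesis using LK by blast
qed

end

theorem proposition4p4: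
  fixes p p' r s L :: int and n :: nat and \<nu> :: "nat \<Rightarrow> nat"
  assumes "1 < p" and "p < p'" and "2 * p' < 3 * p" and "coprime p p'"
    and "1 \<le> r" and "r < p" and "1 \<le> s" and "s < p'"
    and "\<bar>p' * (r - s) + p * s\<bar> = 1"
    and "cf_expansion (of_int p' / of_int (p' - p)) n \<nu>"
  shows
    "sum' (\<lambda>m. q powi \<lfloor>B''_form n \<nu> m / 2\<rfloor> *
        (\<Prod>j=1..dim'' n \<nu>.
          qbinom \<lfloor>of_int (L * of_bool (j = 1)) + of_int (I''_app n \<nu> m j) / (2 :: rat)\<rfloor> (m j)))
       (summation_vectors n \<nu>)
     = sum' (\<lambda>j. q powi (j * (p' * (2 * p' - p) * j + 1)) * qtrinom L (2 * p' * j)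
        - q powi ((p' * j + s) * ((2 * p' - p) * j + r + s)) * qtrinom L (2 * p' * j + 2 * s))
       (UNIV :: int set)"
proof -
  interpret fermionic_shape n \<nu>
    using assms by (intro fermionic_shapeI) auto
  define P where "P = p' - p"
  have P: "0 < P" "P < p'" using assms by (auto simp: P_def)
  have det: "\<bar>p' * r - P * s\<bar> = 1"
    using assms(9) by (simp add: P_def algebra_simps)
  have ratio: "chain_ratio (steps 1) = of_int p' / of_int P"
    using assms(10) chain_ratio_steps_1 by (simp add: cf_expansion_def P_def)
  \<comment> \<open>Since t_m \<ge> 3, row 1 is no swap row. Its Burge step is the inner sum of
    \<open>fermionic_sum_eq\<close>, so the chain starts at row 2, with ratio (Q - P)/P.\<close>
  have "1 < d" "\<not> swap_at 1"
    using dim'_ge tpos_ge by (force simp: swap_at_def)+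
  then have "chain_ratio (steps 1) = 1 + chain_ratio (steps 2)"
    by (simp add: steps_Cons numeral_2_eq_2)
  then have "of_int (p' - P) = chain_ratio (steps 2) * of_int P"
    using ratio P by (simp add: field_simps)
  note chain = fermionic_chain_trinomial[OF P det this]
  have e: "P + p' = 2 * p' - p" "2 * (p' * j) = 2 * p' * j" "2 * (p' * j + s) = 2 * p' * j + 2 * s"
    "(2 * p' - p) * j + (r + s) = (2 * p' - p) * j + r + s" for j
    by (simp_all add: P_def)
  show ?thesis
    using fermionic_sum_eq[of L] chain by (elim exE conjE) (simp only: bosonic_sum_def e)
qed

end
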